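(* Let $\{X_1,\dots,X_n\}\subset\mathbb{M}_d$ be an independent family of random matrices, and form the product $Z_n=(I+X_n)\cdots(I+X_1)$. Assume that $$\|\mathbb{E}X_i\|\le\xi_i\quad\text{and}\quad\|X_i-\mathbb{E}X_i\|\le\sigma_i\ \text{ almost surely, for } i=1,\dots,n.$$ Define $\xi=\sum_{i=1}^n\xi_i$ and $v=\sum_{i=1}^n\sigma_i^2$. Then $$\mathbb{E}\|Z_n\|\le\exp\big(\xi+\sqrt{2v\log d}\big)\quad\text{when } 2v\le\log d;$$ $$\mathbb{E}\|Z_n-\mathbb{E}Z_n\|\le e^{\xi+1}\sqrt{v\,(1+2\log d)}\quad\text{when } v\,(1+2\log d)\le1.$$ Moreover, if $v>0$, $$\mathbb{P}\{\|Z_n\|\ge t\,e^{\xi}\}\le d\cdot\exp\Big(\frac{-\log^2t}{2v}\Big)\quad\text{when } t>0 \text{ and } \log t\ge2v;$$ $$\mathbb{P}\{\|Z_n-\mathbb{E}Z_n\|\ge t\,e^{\xi}\}\le(d\vee e)\cdot\exp\Big(\frac{-t^2}{2e^2v}\Big)\quad\text{when } 0\le t\le e.$$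
   Context: $\mathbb{M}_d$ is the algebra of $d\times d$ complex matrices, $I$ is the identity matrix, $\|\cdot\|$ is the spectral norm ($\ell_2$ operator norm), and $a\vee b=\max\{a,b\}$. $e$ is Euler's number, and $\log^2t$ means $(\log t)^2$. *)

theory Defs
  imports "HOL-Probability.Probability"
begin

text \<open>The type \<^typ>\<open>complex ^ 'd\<close> carries the \<open>\<ell>\<^sub>2\<close> norm, so \<^const>\<open>onorm\<close> of
  \<open>x \<mapsto> A x\<close> is the spectral norm.  The norm that the library puts on the matrix type
  itself is the Frobenius norm; it is only used as a topology, for measurability and
  Bochner integrals.\<close>

definition spectral_norm :: "complex ^ 'd ^ 'd \<Rightarrow> real" where
  "spectral_norm A = onorm (\<lambda>x. A *v x)"

text \<open>\<open>perturbed_prod X n = (I + X n) \<cdots> (I + X 1)\<close>; the value \<open>X 0\<close> is not used.\<close>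

primrec perturbed_prod :: "(nat \<Rightarrow> complex ^ 'd ^ 'd) \<Rightarrow> nat \<Rightarrow> complex ^ 'd ^ 'd" where
  "perturbed_prod X 0 = mat 1"
| "perturbed_prod X (Suc n) = (mat 1 + X (Suc n)) ** perturbed_prod X n"

end

theory Submission
  imports Defs
begin

text \<open>
  Everything is done in the Schatten norm of even exponent \<open>p = 2m\<close>, where \<open>tr |A|\<^sup>p\<close> is a
  trace of an alternating word \<open>A A* A A* \<cdots>\<close>.  A reflection argument bounds the trace of every
  word by the product of the Schatten norms of its letters; expanding \<open>tr |A \<plusminus> B|\<^sup>p\<close> into words
  then gives the sharp two-point inequality, and from it uniform smoothness: if \<open>E Y = 0\<close> then
  adding \<open>Y\<close> to a fixed matrix increases the squared norm by at most \<open>(p - 1) |Y|\<^sup>2\<close>.  Applied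
  conditionally to each new factor of the product this yields, with
  \<open>G = e\<^bsup>2\<xi> + (p-1)v\<^esup>\<close> and \<open>H = e\<^bsup>2\<xi>\<^esup>(e\<^bsup>(p-1)v\<^esup> - 1)\<close>,
  \<open>E tr |Z|\<^sup>p \<le> d G\<^bsup>p/2\<^esup>\<close> and \<open>E tr |Z - E Z|\<^sup>p \<le> d H\<^bsup>p/2\<^esup>\<close>.  Jensen or Markov and the choice of
  \<open>p\<close> give the four bounds; the optimal real \<open>p\<close> may be rounded to an even integer.
\<close>

subsection \<open>Traces of words\<close>

text \<open>The constant \<open>p - 1\<close> enters the exponents of the final bounds, so a factor
  lost there could not be absorbed; this dictates the route. Since the letters do not commute, no
  binomial formula applies to matrices: the scalar binomial sum is reached by bounding each word
  separately, and even exponents are what makes the power a finite sum of words. The two-point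
  inequality concerns \<open>A + B\<close> and \<open>A - B\<close>, whereas a centred
  \<open>Y\<close> need not be symmetric. Bounding the part of \<open>- Y\<close> from below by
  convexity in a single step would double \<open>p - 1\<close>, hence the passage through many small
  steps. The recursion lives on squared norms, that is on m-th roots of expected Schatten powers,
  because there Minkowski's inequality of exponent m lets the contributions of the old product and
  of the new noise be added. In the fluctuation recursion the noise of a new factor multiplies the
  whole previous product and not only its deviation from the mean, so \<open>H\<close> is fed by
  \<open>G\<close>.\<close>

definition madj :: "complex ^ 'd ^ 'd \<Rightarrow> complex ^ 'd ^ 'd" where
  "madj A = (\<chi> i j. cnj (A $ j $ i))"

lemma madj_madj [simp]: "madj (madj A) = A"
  by (simp add: madj_def vec_eq_iff)

lemma madj_mat_1 [simp]: "madj (mat 1) = mat 1"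
  by (simp add: madj_def mat_def vec_eq_iff)

lemma madj_mult: "madj (A ** B) = madj B ** madj A"
  by (simp add: madj_def matrix_matrix_mult_def vec_eq_iff mult.commute)

lemma madj_add: "madj (A + B) = madj A + madj B"
  by (simp add: madj_def vec_eq_iff)

lemma madj_scaleR: "madj (c *\<^sub>R A) = c *\<^sub>R madj A"
  by (simp add: madj_def vec_eq_iff)

lemma bounded_linear_madj: "bounded_linear madj"
  by (intro linear_conv_bounded_linear[THEN iffD1] linearI) (simp_all add: madj_add madj_scaleR)

lemma bounded_bilinear_matrix_mult:
  "bounded_bilinear ((**) :: complex ^ 'd ^ 'd \<Rightarrow> complex ^ 'd ^ 'd \<Rightarrow> complex ^ 'd ^ 'd)"
proof (rule bilinear_conv_bounded_bilinear[THEN iffD1])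
  show "bilinear ((**) :: complex ^ 'd ^ 'd \<Rightarrow> complex ^ 'd ^ 'd \<Rightarrow> complex ^ 'd ^ 'd)"
    unfolding bilinear_def
    by (auto intro!: linearI simp: matrix_add_ldistrib matrix_matrix_mult_def vec_eq_iff
        ring_distribs sum.distrib scaleR_sum_right)
qed

interpretation matrix_mult: bounded_bilinear
  "(**) :: complex ^ 'd ^ 'd \<Rightarrow> complex ^ 'd ^ 'd \<Rightarrow> complex ^ 'd ^ 'd"
  by (rule bounded_bilinear_matrix_mult)

lemma bounded_linear_trace: "bounded_linear (trace :: complex ^ 'd ^ 'd \<Rightarrow> complex)"
  by (intro linear_conv_bounded_linear[THEN iffD1] linearI)
     (simp_all add: trace_def sum.distrib scaleR_sum_right)

section \<open>The Frobenius norm and its trace pairing\<close>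

lemma norm_matrix_eq:
  fixes A :: "complex ^ 'd ^ 'd"
  shows "(norm A)\<^sup>2 = (\<Sum>i\<in>UNIV. \<Sum>j\<in>UNIV. (cmod (A $ i $ j))\<^sup>2)"
  by (simp add: norm_vec_def L2_set_def sum_nonneg)

lemma norm_matrix_eq_L2_set:
  fixes A :: "complex ^ 'd ^ 'd"
  shows "norm A = L2_set (\<lambda>(i, j). cmod (A $ i $ j)) UNIV"
  by (simp add: norm_vec_def L2_set_def sum_nonneg sum.cartesian_product case_prod_unfold)

lemma norm_madj [simp]: "norm (madj A) = norm A"
proof -
  have "(norm (madj A))\<^sup>2 = (norm A)\<^sup>2"
    unfolding norm_matrix_eq by (subst sum.swap) (simp add: madj_def)
  then show ?thesis by simp
qed

lemma trace_mult_madj: "trace (A ** madj A) = of_real ((norm A)\<^sup>2)"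
  by (simp add: norm_matrix_eq trace_def matrix_matrix_mult_def madj_def complex_norm_square
      del: of_real_power)

lemma norm_trace_mult_le:
  fixes A B :: "complex ^ 'd ^ 'd"
  shows "cmod (trace (A ** B)) \<le> norm A * norm B"
proof -
  have "cmod (trace (A ** B)) \<le> (\<Sum>i\<in>UNIV. \<Sum>j\<in>UNIV. cmod (A $ i $ j * B $ j $ i))"
    unfolding trace_def matrix_matrix_mult_def
    by (auto intro!: order.trans[OF norm_sum] sum_mono)
  also have "\<dots> = (\<Sum>(i, j)\<in>UNIV. \<bar>cmod (A $ i $ j)\<bar> * \<bar>cmod (madj B $ i $ j)\<bar>)"
    by (simp add: sum.cartesian_product norm_mult madj_def)
  also have "\<dots> \<le> norm A * norm (madj B)"
    unfolding norm_matrix_eq_L2_set case_prod_unfold by (rule L2_set_mult_ineq)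
  finally show ?thesis by simp
qed

section \<open>Words, mirror images and alternating words\<close>

definition mprod :: "(complex ^ 'd ^ 'd) list \<Rightarrow> complex ^ 'd ^ 'd" where
  "mprod ws = foldr (**) ws (mat 1)"

lemma mprod_Nil [simp]: "mprod [] = mat 1"
  and mprod_Cons [simp]: "mprod (A # ws) = A ** mprod ws"
  by (simp_all add: mprod_def)

lemma mprod_append: "mprod (u @ w) = mprod u ** mprod w"
  by (induction u) (simp_all add: matrix_mul_assoc)

definition ladj :: "(complex ^ 'd ^ 'd) list \<Rightarrow> (complex ^ 'd ^ 'd) list" where
  "ladj u = rev (map madj u)"

lemma length_ladj [simp]: "length (ladj u) = length u"
  and ladj_append: "ladj (u @ w) = ladj w @ ladj u"
  and set_ladj: "set (ladj u) = madj ` set u"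
  by (simp_all add: ladj_def)

lemma mprod_ladj: "mprod (ladj u) = madj (mprod u)"
  by (induction u) (simp_all add: ladj_def mprod_append madj_mult)

lemma trace_mprod_rotate: "trace (mprod (u @ w)) = trace (mprod (w @ u))"
  unfolding mprod_append by (rule trace_mul_sym)

lemma trace_mprod_ladj: "trace (mprod (u @ ladj u)) = of_real ((norm (mprod u))\<^sup>2)"
  by (simp add: mprod_append mprod_ladj trace_mult_madj)

primrec alt :: "nat \<Rightarrow> complex ^ 'd ^ 'd \<Rightarrow> (complex ^ 'd ^ 'd) list" where
  "alt 0 A = []"
| "alt (Suc n) A = A # alt n (madj A)"

lemma length_alt [simp]: "length (alt n A) = n"
  by (induction n arbitrary: A) simp_all

lemma alt_add: "alt (m + n) A = alt m A @ alt n (if even m then A else madj A)"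
  by (induction m arbitrary: A) simp_all

text \<open>The last letter of a nonempty \<open>alt n A\<close> is \<open>A\<close> for odd
  \<open>n\<close> and \<open>madj A\<close> for even \<open>n\<close>, and the mirror image starts
  with the adjoint of that letter. Hence a word followed by its mirror image goes on alternating
  across the middle.\<close>

lemma ladj_alt: "ladj (alt n A) = alt n (if even n then A else madj A)"
proof (induction n)
  case (Suc n)
  have "alt (Suc n) A = alt n A @ alt 1 (if even n then A else madj A)"
    using alt_add[of n 1 A] by simp
  then have "ladj (alt (Suc n) A) =
      (if even n then madj A else A) # alt n (if even n then A else madj A)"
    using Suc by (auto simp: ladj_append) (auto simp: ladj_def)
  then show ?case by auto
qed (simp add: ladj_def)

lemma alt_append_ladj: "alt n A @ ladj (alt n A) = alt (2 * n) A"
  unfolding ladj_alt mult_2 alt_add ..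

text \<open>\<open>schatten_pow m A\<close> is \<open>tr |A|\<^bsup>2m\<^esup>\<close>, the \<open>2m\<close>-th power of the Schatten \<open>2m\<close>-norm: the trace of
  \<open>A A* A A* \<cdots>\<close> (\<open>2m\<close> factors) is the squared Frobenius norm of the first half of this product.\<close>

definition schatten_pow :: "nat \<Rightarrow> complex ^ 'd ^ 'd \<Rightarrow> real" where
  "schatten_pow m A = (norm (mprod (alt m A)))\<^sup>2"

lemma schatten_pow_nonneg [simp]: "schatten_pow m A \<ge> 0"
  by (simp add: schatten_pow_def)

lemma trace_alt: "trace (mprod (alt (2 * m) A)) = of_real (schatten_pow m A)"
  by (metis alt_append_ladj schatten_pow_def trace_mprod_ladj)

text \<open>Moving the first letter to the end does not change the trace, and it turns the
  alternating word that starts with \<open>A\<close> into the one that starts with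
  \<open>madj A\<close>.\<close>

lemma schatten_pow_madj [simp]: "schatten_pow m (madj A) = schatten_pow m A"
proof (cases m)
  case (Suc k)
  have "alt (2 * m) A = A # alt (2 * k + 1) (madj A)"
    by (simp add: Suc)
  then have "trace (mprod (alt (2 * m) A)) = trace (mprod (alt (2 * k + 1) (madj A) @ [A]))"
    using trace_mprod_rotate[of "[A]" "alt (2 * k + 1) (madj A)"]
    by (simp only: append_Cons append_Nil)
  also have "alt (2 * k + 1) (madj A) @ [A] = alt (2 * m) (madj A)"
    using alt_add[of "2 * k + 1" 1 "madj A"] by (simp add: Suc)
  finally show ?thesis unfolding trace_alt by simp
qed (simp add: schatten_pow_def)

text \<open>Reflection argument: by Cauchy--Schwarz \<open>|tr (UV)|\<^sup>2 \<le> tr (UU*) tr (V*V)\<close>, so a word of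
  maximal trace stays maximal when its second half is replaced by the mirror image of the first.
  Mirroring doubles an alternating run \<open>A A* A \<cdots>\<close> that ends in the middle, until the run is the
  whole word.\<close>

lemma norm_trace_mprod_le_1:
  fixes w :: "(complex ^ 'd ^ 'd) list"
  assumes m: "m > 0" and len: "length w = 2 * m"
    and le1: "\<And>A. A \<in> set w \<Longrightarrow> schatten_pow m A \<le> 1"
  shows "cmod (trace (mprod w)) \<le> 1"
proof -
  \<comment> \<open>The alphabet is closed under adjoints so that mirroring stays inside
    \<open>W\<close>; it is finite, so the maximum \<open>K\<close> is attained.\<close>
  define L where "L = set w \<union> madj ` set w"
  define W where "W = {u. set u \<subseteq> L \<and> length u = 2 * m}"
  define T where "T u = cmod (trace (mprod u))" for u :: "(complex ^ 'd ^ 'd) list"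
  define K where "K = Max (T ` W)"
  have madj_L: "madj ` L \<subseteq> L" by (auto simp: L_def)
  have sch_L: "schatten_pow m A \<le> 1" if "A \<in> L" for A
    using that le1 by (auto simp: L_def)
  have "finite L" by (simp add: L_def)
  then have fin: "finite W" unfolding W_def by (rule finite_lists_length_eq)
  have wW: "w \<in> W" using len by (auto simp: W_def L_def)
  have le: "T u \<le> K" if "u \<in> W" for u
    unfolding K_def using fin that by (intro Max_ge) auto
  have "K \<in> T ` W" unfolding K_def using fin wW by (intro Max_in) auto
  then obtain w0 where w0: "w0 \<in> W" "T w0 = K" by auto
  have Tw: "T w \<le> K" using le wW by simp
  have T_mirror: "T (u @ ladj u) = (norm (mprod u))\<^sup>2" for u
    unfolding T_def trace_mprod_ladj norm_of_real by simp
  have rot: "T (u @ z) = T (z @ u)" for u z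
    unfolding T_def by (subst trace_mprod_rotate) (rule refl)
  have "K \<le> 1"
  proof (cases "K > 0")
    case True
    have mirror: "u @ ladj u \<in> W \<and> T (u @ ladj u) = K"
      if "u @ z \<in> W" "T (u @ z) = K" "length u = m" for u z
    proof -
      have uW: "u @ ladj u \<in> W" and zW: "ladj z @ z \<in> W"
        using that(1,3) madj_L by (auto simp: W_def set_ladj)
      have "K\<^sup>2 \<le> (norm (mprod u) * norm (mprod z))\<^sup>2"
        using norm_trace_mult_le[of "mprod u" "mprod z"] that(2) True
        by (intro power_mono) (simp_all add: T_def mprod_append)
      also have "\<dots> = T (u @ ladj u) * T (ladj z @ z)"
        by (subst rot[of "ladj z"]) (simp add: T_mirror power_mult_distrib)
      also have "\<dots> \<le> T (u @ ladj u) * K"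
        using le[OF zW] by (intro mult_left_mono) (simp_all add: T_def)
      finally have "K \<le> T (u @ ladj u)" using True by (simp add: power2_eq_square)
      with le[OF uW] uW show ?thesis by simp
    qed
    define P where "P r \<longleftrightarrow> r \<le> m \<and> (\<exists>A z. A \<in> L \<and> alt r A @ z \<in> W \<and> T (alt r A @ z) = K)" for r
    have P_double: "P (min (2 * r) m)" if Pr: "P r" for r
    proof -
      obtain A z where A: "r \<le> m" "A \<in> L" "alt r A @ z \<in> W" "T (alt r A @ z) = K"
        using Pr by (auto simp: P_def)
      \<comment> \<open>The run has length \<open>r\<close> and \<open>z2\<close> has length
        \<open>m - r\<close>: rotating \<open>z2\<close> to the front makes the run end exactly in
        the middle of the word.\<close>
      define z1 z2 where "z1 = take m z" and "z2 = drop m z"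
      have z: "z = z1 @ z2" "length z1 = m" "length z2 = m - r"
        using A(1,3) unfolding z1_def z2_def W_def by auto
      have "(z2 @ alt r A) @ z1 \<in> W" "T ((z2 @ alt r A) @ z1) = K" "length (z2 @ alt r A) = m"
        using A(3,4) A(1) z(2,3) rot[of "z2" "alt r A @ z1"] unfolding z(1) W_def
        by (simp_all add: Un_commute Un_left_commute)
      note * = mirror[OF this]
      have eq: "(z2 @ alt r A) @ ladj (z2 @ alt r A) = z2 @ alt (2 * r) A @ ladj z2"
        by (simp only: ladj_append alt_append_ladj[symmetric] append_assoc)
      have **: "alt (2 * r) A @ (ladj z2 @ z2) \<in> W" "T (alt (2 * r) A @ (ladj z2 @ z2)) = K"
        using * rot[of z2 "alt (2 * r) A @ ladj z2"] unfolding eq W_def by auto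
      \<comment> \<open>The doubled run may be longer than half of the word; the surplus goes into
        the unspecified rest, since a run of length \<open>m\<close> is all that the last mirroring
        needs.\<close>
      have "2 * r = min (2 * r) m + (2 * r - min (2 * r) m)" by simp
      then obtain y where y: "alt (2 * r) A = alt (min (2 * r) m) A @ y"
        using alt_add by metis
      show ?thesis unfolding P_def
        using ** A(2) unfolding y
        by (intro conjI exI[of _ A] exI[of _ "y @ ladj z2 @ z2"]) simp_all
    qed
    have "P 1"
    proof -
      obtain A z where "w0 = A # z" using w0 m by (cases w0) (auto simp: W_def)
      with w0 m show ?thesis unfolding P_def W_def
        by (intro conjI exI[of _ A] exI[of _ z]) auto
    qed
    have P_pow: "P (min (2 ^ k) m)" for k
    proof (induction k)
      case 0
      then show ?case using \<open>P 1\<close> m by (simp add: min_def)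
    next
      case (Suc k)
      have "min (2 * min (2 ^ k) m) m = min (2 ^ Suc k) m" by (auto simp: min_def)
      with P_double[OF Suc] show ?case by simp
    qed
    \<comment> \<open>\<open>m\<close> doublings suffice because \<open>m < 2 ^ m\<close>.\<close>
    have "min (2 ^ m) m = m" by (intro min_absorb2 less_imp_le less_exp)
    then have "P m" using P_pow[of m] by (simp only:)
    then obtain A z where A: "A \<in> L" "alt m A @ z \<in> W" "T (alt m A @ z) = K"
      by (auto simp: P_def)
    then have "T (alt m A @ ladj (alt m A)) = K" using mirror[of "alt m A" z] by simp
    then show ?thesis using sch_L[OF A(1)] by (simp add: T_mirror schatten_pow_def)
  qed simp
  with Tw show ?thesis by (simp add: T_def)
qed

text \<open>Normalising a letter means dividing by its Schatten norm, which may vanish. Bounds are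
  therefore proved for all strictly larger numbers, and this passage to the limit restores the norm
  itself.\<close>

lemma le_if_le_at_right:
  fixes f :: "real \<Rightarrow> real"
  assumes "isCont f x" and "\<And>a. a > x \<Longrightarrow> y \<le> f a"
  shows "y \<le> f x"
proof (rule tendsto_lowerbound[where F = "at_right x"])
  show "(f \<longlongrightarrow> f x) (at_right x)"
    using assms(1) by (simp add: continuous_within isCont_def filterlim_at_split)
  show "eventually (\<lambda>a. y \<le> f a) (at_right x)"
    using assms(2) by (auto intro!: eventually_at_rightI[of x "x + 1"])
qed simp

subsection \<open>The spectral norm\<close>

lemma norm_mult_vec_le:
  fixes A :: "complex ^ 'd ^ 'd"
  shows "norm (A *v x) \<le> norm A * norm x"
proof -
  have comp: "cmod ((A *v x) $ i) \<le> norm (A $ i) * norm x" for i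
  proof -
    have "cmod ((A *v x) $ i) \<le> (\<Sum>j\<in>UNIV. \<bar>cmod (A $ i $ j)\<bar> * \<bar>cmod (x $ j)\<bar>)"
      unfolding matrix_vector_mult_def
      by (auto intro!: order.trans[OF norm_sum] simp: norm_mult)
    also have "\<dots> \<le> norm (A $ i) * norm x"
      unfolding norm_vec_def by (rule L2_set_mult_ineq)
    finally show ?thesis .
  qed
  have "norm (A *v x) \<le> L2_set (\<lambda>i. norm (A $ i) * norm x) UNIV"
    unfolding norm_vec_def[of "A *v x"] by (intro L2_set_mono comp) simp
  also have "\<dots> = norm A * norm x"
    unfolding norm_vec_def[of A] by (subst L2_set_left_distrib) simp_all
  finally show ?thesis .
qed

lemma norm_mult_vec_le_spectral: "norm (A *v x) \<le> spectral_norm A * norm x"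
  unfolding spectral_norm_def by (rule onorm) simp

lemma spectral_norm_leI: "(\<And>x. norm (A *v x) \<le> c * norm x) \<Longrightarrow> spectral_norm A \<le> c"
  unfolding spectral_norm_def by (rule onorm_le)

lemma spectral_norm_nonneg [simp]: "0 \<le> spectral_norm A"
  unfolding spectral_norm_def by (rule onorm_pos_le) simp

lemma spectral_norm_le_norm: "spectral_norm A \<le> norm A"
  by (intro spectral_norm_leI norm_mult_vec_le)

lemma spectral_norm_add_le: "spectral_norm (A + B) \<le> spectral_norm A + spectral_norm B"
  unfolding spectral_norm_def matrix_vector_mult_add_rdistrib by (rule onorm_triangle) simp_all

lemma spectral_norm_mat_1_le: "spectral_norm (mat 1 :: complex ^ 'd ^ 'd) \<le> 1"
  by (intro spectral_norm_leI) simp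

lemma continuous_on_spectral_norm: "continuous_on UNIV spectral_norm"
proof -
  have diff: "spectral_norm A - spectral_norm B \<le> norm (A - B)" for A B :: "complex ^ 'd ^ 'd"
    using spectral_norm_add_le[of "A - B" B] spectral_norm_le_norm[of "A - B"] by simp
  then have "\<bar>spectral_norm A - spectral_norm B\<bar> \<le> norm (A - B)" for A B :: "complex ^ 'd ^ 'd"
    using diff[of A B] diff[of B A] by (simp add: abs_le_iff norm_minus_commute)
  then have "1-lipschitz_on UNIV (spectral_norm :: complex ^ 'd ^ 'd \<Rightarrow> real)"
    by (intro lipschitz_onI) (simp_all add: dist_norm)
  then show ?thesis by (rule lipschitz_on_continuous_on)
qed

text \<open>Left multiplication acts on each column separately, and the squared Frobenius norm is
  the sum over the columns.\<close>

lemma norm_mult_le_spectral: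
  fixes A U :: "complex ^ 'd ^ 'd"
  shows "norm (A ** U) \<le> spectral_norm A * norm U"
proof -
  have sq: "(norm U)\<^sup>2 = (\<Sum>j\<in>UNIV. (norm (column j U))\<^sup>2)" for U :: "complex ^ 'd ^ 'd"
    unfolding norm_matrix_eq
    by (subst sum.swap) (simp add: norm_vec_def L2_set_def sum_nonneg column_def)
  have col: "column j (A ** U) = A *v column j U" for j
    by (simp add: column_def matrix_matrix_mult_def matrix_vector_mult_def vec_eq_iff)
  have "(norm (A ** U))\<^sup>2 \<le> (\<Sum>j\<in>UNIV. (spectral_norm A * norm (column j U))\<^sup>2)"
    unfolding sq col by (intro sum_mono power_mono norm_mult_vec_le_spectral) simp
  also have "\<dots> = (spectral_norm A * norm U)\<^sup>2"
    by (simp add: sq power_mult_distrib sum_distrib_left)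
  finally show ?thesis by (rule power2_le_imp_le) simp
qed

lemma inner_mult_vec_left:
  fixes A :: "complex ^ 'd ^ 'd"
  shows "(A *v x) \<bullet> y = x \<bullet> (madj A *v y)"
proof -
  have eq: "u \<bullet> w = Re (\<Sum>i\<in>UNIV. cnj (u $ i) * w $ i)" for u w :: "complex ^ 'd"
    by (simp add: inner_vec_def inner_complex_def)
  have "(\<Sum>i\<in>UNIV. cnj ((A *v x) $ i) * y $ i) = (\<Sum>i\<in>UNIV. cnj (x $ i) * (madj A *v y) $ i)"
    unfolding matrix_vector_mult_def madj_def
    by (simp add: sum_distrib_left sum_distrib_right)
       (subst sum.swap, simp add: algebra_simps)
  then show ?thesis unfolding eq by simp
qed

subsection \<open>Schatten powers\<close>

text \<open>The dimension enters the moment bounds here, as the Schatten power of the empty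
  product.\<close>

lemma schatten_pow_mat_1: "schatten_pow m (mat 1 :: complex ^ 'd ^ 'd) = real CARD('d)"
proof -
  have "mprod (alt n (mat 1)) = (mat 1 :: complex ^ 'd ^ 'd)" for n
    by (induction n) simp_all
  moreover have "complex_of_real ((norm (mat 1 :: complex ^ 'd ^ 'd))\<^sup>2) = of_real (real CARD('d))"
    using trace_mult_madj[of "mat 1 :: complex ^ 'd ^ 'd"] by (simp add: trace_I)
  ultimately show ?thesis
    unfolding schatten_pow_def of_real_eq_iff by simp
qed

lemma continuous_on_schatten_pow: "continuous_on UNIV (schatten_pow m)"
proof -
  have *: "continuous_on UNIV (\<lambda>A. mprod (alt n (f A)))"
    if "continuous_on UNIV f" for n and f :: "complex ^ 'd ^ 'd \<Rightarrow> complex ^ 'd ^ 'd"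
    using that
  proof (induction n arbitrary: f)
    case (Suc n)
    have "continuous_on UNIV (\<lambda>A. madj (f A))"
      using Suc.prems by (rule bounded_linear.continuous_on[OF bounded_linear_madj])
    from matrix_mult.continuous_on[OF Suc.prems Suc.IH[OF this]] show ?case by simp
  qed simp
  show ?thesis
    unfolding schatten_pow_def
    by (intro continuous_on_power continuous_on_norm *[of "\<lambda>A. A"] continuous_on_id)
qed

text \<open>Adjoints alternate with the position, whichever letter is chosen there: these words are
  the terms in the expansion of an alternating product of \<open>A + B\<close>.\<close>

primrec aword :: "bool list \<Rightarrow> complex ^ 'd ^ 'd \<Rightarrow> complex ^ 'd ^ 'd \<Rightarrow> (complex ^ 'd ^ 'd) list" where
  "aword [] A B = []"
| "aword (c # w) A B = (if c then B else A) # aword w (madj A) (madj B)"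

text \<open>The commutative counterpart of a word, with scalars for both letters. At
  \<open>1\<close> and \<open>- 1\<close> it is the sign that records the parity of the number of
  \<open>True\<close> entries.\<close>

definition wt :: "bool list \<Rightarrow> real \<Rightarrow> real \<Rightarrow> real" where
  "wt w a b = (\<Prod>c\<leftarrow>w. if c then b else a)"

lemma wt_Nil [simp]: "wt [] a b = 1"
  and wt_Cons [simp]: "wt (c # w) a b = (if c then b else a) * wt w a b"
  by (simp_all add: wt_def)

lemma wt_mult: "wt w (a * a') (b * b') = wt w a b * wt w a' b'"
  by (induction w) simp_all

lemma wt_replicate_False: "wt (replicate n False) a b = a ^ n"
  by (induction n) simp_all

lemma trace_scaleR: "trace (c *\<^sub>R (A :: complex ^ 'd ^ 'd)) = c *\<^sub>R trace A"
  by (simp add: trace_def scaleR_sum_right)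

lemma wt_pos: "a > 0 \<Longrightarrow> b > 0 \<Longrightarrow> wt w a b > 0"
  by (induction w) auto

lemma abs_wt_sign: "\<bar>wt w 1 (- 1)\<bar> = 1"
  by (induction w) (auto simp: abs_mult)

lemma length_aword [simp]: "length (aword w A B) = length w"
  by (induction w arbitrary: A B) simp_all

lemma set_aword: "set (aword w A B) \<subseteq> {A, madj A, B, madj B}"
proof (induction w arbitrary: A B)
  case (Cons c w)
  show ?case using Cons[of "madj A" "madj B"] by auto
qed simp

lemma aword_replicate_False: "aword (replicate n False) A B = alt n A"
  by (induction n arbitrary: A B) simp_all

lemma mprod_aword_scaleR:
  "mprod (aword w (a *\<^sub>R A) (b *\<^sub>R B)) = wt w a b *\<^sub>R mprod (aword w A B)"
  by (induction w arbitrary: A B)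
     (simp_all add: madj_scaleR matrix_mult.scaleR_left matrix_mult.scaleR_right)

lemma schatten_pow_scaleR: "schatten_pow m (c *\<^sub>R A) = c ^ (2 * m) * schatten_pow m A"
  using mprod_aword_scaleR[of "replicate m False" c A c A]
  by (simp add: schatten_pow_def aword_replicate_False wt_replicate_False power_mult_distrib
      flip: power_mult) (simp add: mult.commute power_mult)

lemma schatten_pow_normalize:
  assumes "a > 0" "schatten_pow m A \<le> a ^ (2 * m)"
  shows "schatten_pow m ((1 / a) *\<^sub>R A) \<le> 1"
  using assms by (simp add: schatten_pow_scaleR power_divide)

text \<open>Hoelder's inequality for words: dividing each letter by its bound reduces it to letters
  of Schatten norm at most one, and homogeneity restores the weight.\<close>

lemma norm_trace_aword_le:
  assumes m: "m > 0" and len: "length w = 2 * m" and pos: "a > 0" "b > 0"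
    and "schatten_pow m A \<le> a ^ (2 * m)" "schatten_pow m B \<le> b ^ (2 * m)"
  shows "cmod (trace (mprod (aword w A B))) \<le> wt w a b"
proof -
  let ?w = "aword w ((1 / a) *\<^sub>R A) ((1 / b) *\<^sub>R B)"
  have "mprod (aword w A B) = wt w a b *\<^sub>R mprod ?w"
    using mprod_aword_scaleR[of w a "(1 / a) *\<^sub>R A" b "(1 / b) *\<^sub>R B"] pos by simp
  then have "cmod (trace (mprod (aword w A B))) = wt w a b * cmod (trace (mprod ?w))"
    using wt_pos[OF pos, of w] by (simp add: trace_scaleR)
  moreover have "cmod (trace (mprod ?w)) \<le> 1"
  proof (rule norm_trace_mprod_le_1[OF m])
    fix C assume "C \<in> set ?w"
    then show "schatten_pow m C \<le> 1"
      using set_aword[of w "(1 / a) *\<^sub>R A" "(1 / b) *\<^sub>R B"] assms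
      by (auto simp: schatten_pow_normalize)
  qed (simp add: len)
  ultimately show ?thesis using wt_pos[OF pos, of w] by (simp add: mult_left_le)
qed

text \<open>The squared Frobenius norm of a word of length \<open>m\<close> is the trace of the word
  of length \<open>2 * m\<close> that mirroring produces, so the trace bound applies to it.\<close>

lemma norm_aword_le:
  assumes m: "m > 0" and len: "length w = m" and pos: "a > 0" "b > 0"
    and "schatten_pow m A \<le> a ^ (2 * m)" "schatten_pow m B \<le> b ^ (2 * m)"
  shows "norm (mprod (aword w A B)) \<le> wt w a b"
proof -
  let ?w = "aword w ((1 / a) *\<^sub>R A) ((1 / b) *\<^sub>R B)"
  have "mprod (aword w A B) = wt w a b *\<^sub>R mprod ?w"
    using mprod_aword_scaleR[of w a "(1 / a) *\<^sub>R A" b "(1 / b) *\<^sub>R B"] pos by simp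
  then have "norm (mprod (aword w A B)) = wt w a b * norm (mprod ?w)"
    using wt_pos[OF pos, of w] by simp
  moreover have "cmod (trace (mprod (?w @ ladj ?w))) \<le> 1"
  proof (rule norm_trace_mprod_le_1[OF m])
    fix C assume "C \<in> set (?w @ ladj ?w)"
    then show "schatten_pow m C \<le> 1"
      using set_aword[of w "(1 / a) *\<^sub>R A" "(1 / b) *\<^sub>R B"] assms
      by (auto simp: set_ladj schatten_pow_normalize)
  qed (simp add: len)
  then have "(norm (mprod ?w))\<^sup>2 \<le> 1"
    unfolding trace_mprod_ladj norm_of_real by simp
  then have "norm (mprod ?w) \<le> 1" by (simp add: power_le_one_iff abs_square_le_1)
  ultimately show ?thesis using wt_pos[OF pos, of w] by (simp add: mult_left_le)
qed

lemma schatten_pow_root: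
  assumes "m > 0" "root (2 * m) (schatten_pow m A) < a"
  shows "a > 0" and "schatten_pow m A \<le> a ^ (2 * m)"
proof -
  have r: "root (2 * m) (schatten_pow m A) \<ge> 0" using assms(1) by simp
  with assms(2) show "a > 0" by linarith
  have "schatten_pow m A = root (2 * m) (schatten_pow m A) ^ (2 * m)"
    using assms(1) by simp
  also have "\<dots> \<le> a ^ (2 * m)" using r assms(2) by (intro power_mono) auto
  finally show "schatten_pow m A \<le> a ^ (2 * m)" .
qed

text \<open>Only the first letter \<open>C = B ** A\<close> of the alternating word is split.
  Pulling out \<open>B\<close> costs its spectral norm, and Hoelder bounds the remaining word by
  \<open>a * c ^ k\<close>; as the whole word has norm \<open>c ^ Suc k\<close>, the factor
  \<open>c ^ k\<close> cancels.\<close>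

lemma schatten_pow_mult_le:
  fixes A B :: "complex ^ 'd ^ 'd"
  assumes m: "m > 0"
  shows "schatten_pow m (B ** A) \<le> spectral_norm B ^ (2 * m) * schatten_pow m A"
proof -
  define C where "C = B ** A"
  define c where "c = root (2 * m) (schatten_pow m C)"
  have c: "schatten_pow m C = c ^ (2 * m)" "c \<ge> 0" using m by (simp_all add: c_def)
  obtain k where k: "m = Suc k" using m by (cases m) auto
  have main: "schatten_pow m C \<le> (spectral_norm B * a) ^ (2 * m)"
    if a: "root (2 * m) (schatten_pow m A) < a" for a
  proof (cases "c = 0")
    case True
    then show ?thesis using c m schatten_pow_root(1)[OF m a] by simp
  next
    case False
    with c have cpos: "c > 0" by simp
    define V where "V = mprod (alt k (madj C))"
    have "norm (A ** V) = norm (mprod (aword (True # replicate k False) C A))"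
      by (simp add: V_def aword_replicate_False)
    also have "\<dots> \<le> wt (True # replicate k False) c a"
      using schatten_pow_root[OF m a] c cpos k by (intro norm_aword_le[OF m]) auto
    finally have AV: "norm (A ** V) \<le> a * c ^ k" by (simp add: wt_replicate_False)
    have "norm (mprod (alt m C)) = norm (B ** (A ** V))"
      by (simp add: k V_def C_def matrix_mul_assoc)
    also have "\<dots> \<le> spectral_norm B * norm (A ** V)" by (rule norm_mult_le_spectral)
    also have "\<dots> \<le> spectral_norm B * (a * c ^ k)" using AV by (intro mult_left_mono) auto
    finally have "norm (mprod (alt m C)) \<le> spectral_norm B * a * c ^ k" by simp
    moreover have "norm (mprod (alt m C)) = c ^ m"
    proof -
      have "(norm (mprod (alt m C)))\<^sup>2 = (c ^ m)\<^sup>2"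
        using c(1) by (simp add: schatten_pow_def power_even_eq)
      then show ?thesis using cpos by (simp add: power2_eq_iff_nonneg)
    qed
    ultimately have "c \<le> spectral_norm B * a" using cpos by (simp add: k)
    then show ?thesis unfolding c(1) using cpos by (intro power_mono) auto
  qed
  have "schatten_pow m C \<le> (spectral_norm B * root (2 * m) (schatten_pow m A)) ^ (2 * m)"
    by (rule le_if_le_at_right[OF _ main]) (auto intro!: continuous_intros)
  then show ?thesis using m by (simp add: C_def power_mult_distrib)
qed

text \<open>With \<open>R n\<close> the product of \<open>n\<close> alternating factors ending in \<open>\<cdots> A* A\<close>, the sequence
  \<open>norm (R n x)\<close> is log-convex, so for a unit vector its \<open>m\<close>-th term is at least \<open>(norm (A x))^m\<close>.\<close>

lemma spectral_norm_power_le_schatten_pow: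
  fixes A :: "complex ^ 'd ^ 'd"
  assumes m: "m > 0"
  shows "spectral_norm A ^ (2 * m) \<le> schatten_pow m A"
proof -
  \<comment> \<open>The first letter depends on the parity so that the last one, which acts on the
    vector first, is always \<open>A\<close>.\<close>
  define R where "R n = mprod (alt n (if even n then madj A else A))" for n
  define X where "X n = (if even n then A else madj A)" for n :: nat
  have R_Suc: "R (Suc n) = X n ** R n" for n by (simp add: R_def X_def)
  have X_Suc: "X (Suc n) = madj (X n)" for n by (simp add: X_def)
  have "(norm (R m))\<^sup>2 = schatten_pow m (if even m then madj A else A)"
    by (simp add: R_def schatten_pow_def)
  then have Rm: "(norm (R m))\<^sup>2 = schatten_pow m A" by auto
  have unit: "norm (A *v x) ^ m \<le> norm (R m)" if x: "norm x = 1" for x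
  proof (cases "A *v x = 0")
    case False
    define c where "c n = norm (R n *v x)" for n
    have c0: "c 0 = 1" and c1: "c 1 = norm (A *v x)" using x by (simp_all add: c_def R_def)
    have "c 1 > 0" using False c1 by simp
    have logconvex: "(c (Suc n))\<^sup>2 \<le> c n * c (Suc (Suc n))" for n
    proof -
      have "(c (Suc n))\<^sup>2 = (X n *v (R n *v x)) \<bullet> (R (Suc n) *v x)"
        unfolding c_def power2_norm_eq_inner by (simp add: R_Suc matrix_vector_mul_assoc)
      also have "\<dots> = (R n *v x) \<bullet> (R (Suc (Suc n)) *v x)"
        unfolding inner_mult_vec_left by (simp add: R_Suc X_Suc matrix_vector_mul_assoc)
      also have "\<dots> \<le> c n * c (Suc (Suc n))"
        unfolding c_def by (rule norm_cauchy_schwarz)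
      finally show ?thesis .
    qed
    \<comment> \<open>Log-convexity makes the ratios \<open>c (Suc n) / c n\<close> nondecreasing,
      so none is below the first one, \<open>c 1 / c 0 = c 1\<close>. Positivity is carried along to
      justify the division.\<close>
    have "c n > 0 \<and> c (Suc n) \<ge> c 1 * c n" for n
    proof (induction n)
      case 0
      then show ?case using c0 by simp
    next
      case (Suc n)
      then have "c 1 * c n > 0" using \<open>c 1 > 0\<close> by simp
      with Suc have pos: "c (Suc n) > 0" by linarith
      have "c n * (c 1 * c (Suc n)) \<le> c (Suc n) * c (Suc n)"
        using mult_right_mono[of "c 1 * c n" "c (Suc n)" "c (Suc n)"] Suc pos
        by (simp add: mult_ac)
      also have "\<dots> \<le> c n * c (Suc (Suc n))" using logconvex[of n] by (simp add: power2_eq_square)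
      finally show ?case using Suc pos by simp
    qed
    note step = this
    have "c 1 ^ n \<le> c n" for n
    proof (induction n)
      case (Suc n)
      have "c 1 ^ Suc n \<le> c 1 * c n" using Suc \<open>c 1 > 0\<close> by simp
      with step[of n] show ?case by linarith
    qed (simp add: c0)
    then have "norm (A *v x) ^ m \<le> c m" unfolding c1 .
    also have "\<dots> \<le> norm (R m)" using norm_mult_vec_le[of "R m" x] x by (simp add: c_def)
    finally show ?thesis .
  qed (use m in \<open>simp add: zero_power\<close>)
  have "spectral_norm A \<le> root m (norm (R m))"
  proof (rule spectral_norm_leI)
    fix x
    show "norm (A *v x) \<le> root m (norm (R m)) * norm x"
    proof (cases "x = 0")
      case False
      define y where "y = (1 / norm x) *\<^sub>R x"
      have "norm (A *v y) ^ m \<le> root m (norm (R m)) ^ m"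
        using unit[of y] False m by (simp add: y_def)
      then have "norm (A *v y) \<le> root m (norm (R m))"
        using m by (subst (asm) power_mono_iff) simp_all
      moreover have "A *v x = norm x *\<^sub>R (A *v y)"
        using False by (simp add: y_def linear_cmul[OF matrix_vector_mul_linear])
      ultimately show ?thesis
        by (simp add: mult.commute mult_left_mono)
    qed simp
  qed
  then have "spectral_norm A ^ (2 * m) \<le> root m (norm (R m)) ^ (2 * m)"
    by (intro power_mono) auto
  also have "\<dots> = schatten_pow m A"
    using m Rm by (simp add: mult.commute[of 2] power_mult)
  finally show ?thesis .
qed

subsection \<open>The two-point inequality\<close>

text \<open>Both sides are 1 at \<open>j = 0\<close>. From \<open>j\<close> to \<open>j + 1\<close>
  the left side is multiplied by \<open>q (m - j) / (j + 1)\<close> with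
  \<open>q = (2 m - 2 j - 1) / (2 j + 1)\<close>, the right side by the same expression with
  \<open>2 m - 1\<close> in place of \<open>q\<close>. Equality at \<open>j = 1\<close> shows that
  \<open>2 m - 1\<close> cannot be lowered.\<close>

lemma binomial_even_le:
  assumes "j \<le> m"
  shows "real ((2 * m) choose (2 * j)) \<le> real (m choose j) * (2 * real m - 1) ^ j"
  using assms
proof (induction j)
  case (Suc j)
  have step: "real (Suc k) * real (n choose Suc k) = (real n - real k) * real (n choose k)"
    if "k \<le> n" for k n
    using that binomial_absorption[of k n] binomial_absorb_comp[of n k]
    by (metis of_nat_diff of_nat_mult)
  have m: "j < m" using Suc.prems by simp
  define q where "q = (2 * real m - 2 * real j - 1) / (2 * real j + 1)"
  have q: "0 \<le> q" "q \<le> 2 * real m - 1"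
  proof -
    show "0 \<le> q" using m by (simp add: q_def)
    have "2 * real m - 2 * real j - 1 \<le> 2 * real m - 1" by simp
    also have "\<dots> \<le> (2 * real m - 1) * (2 * real j + 1)"
      using m mult_left_mono[of 1 "2 * real m" "real j"] by (simp add: algebra_simps)
    finally show "q \<le> 2 * real m - 1" by (simp add: q_def divide_le_eq)
  qed
  have a: "(2 * real j + 2) * real ((2 * m) choose (2 * Suc j)) =
      (2 * real m - 2 * real j - 1) * real ((2 * m) choose Suc (2 * j))"
    using step[of "Suc (2 * j)" "2 * m"] m by (simp add: algebra_simps)
  have b: "(2 * real j + 1) * real ((2 * m) choose Suc (2 * j)) =
      (2 * real m - 2 * real j) * real ((2 * m) choose (2 * j))"
    using step[of "2 * j" "2 * m"] m by (simp add: algebra_simps)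
  have c: "(real j + 1) * real (m choose Suc j) = (real m - real j) * real (m choose j)"
    using step[of j m] m by (simp add: algebra_simps)
  have "(real j + 1) * real ((2 * m) choose (2 * Suc j)) =
      q * (real m - real j) * real ((2 * m) choose (2 * j))"
  proof -
    have "(2 * real j + 1) * ((2 * real j + 2) * real ((2 * m) choose (2 * Suc j))) =
        (2 * real m - 2 * real j - 1) * ((2 * real m - 2 * real j) * real ((2 * m) choose (2 * j)))"
      unfolding a b[symmetric] by (simp add: mult_ac)
    then show ?thesis by (simp add: q_def field_simps)
  qed
  also have "\<dots> \<le> (2 * real m - 1) * (real m - real j) *
      (real (m choose j) * (2 * real m - 1) ^ j)"
    using q m Suc by (intro mult_mono) auto
  also have "\<dots> = (2 * real m - 1) ^ Suc j * ((real m - real j) * real (m choose j))"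
    by simp
  also have "\<dots> = (real j + 1) * (real (m choose Suc j) * (2 * real m - 1) ^ Suc j)"
    unfolding c[symmetric] by simp
  finally show ?case by (simp add: mult_le_cancel_left del: binomial_Suc_Suc)
qed simp

lemma sum_even_indices:
  fixes f :: "nat \<Rightarrow> real"
  assumes "\<And>k. odd k \<Longrightarrow> f k = 0"
  shows "(\<Sum>k\<le>2 * m. f k) = (\<Sum>j\<le>m. f (2 * j))"
  by (induction m) (use assms in auto)

text \<open>The two-point inequality for scalars: odd powers of \<open>b\<close> cancel, and the
  even ones are compared coefficient by coefficient with the binomial expansion of the right
  side.\<close>

lemma even_part_power_le:
  fixes a b :: real
  shows "((a + b) ^ (2 * m) + (a - b) ^ (2 * m)) / 2 \<le> (a\<^sup>2 + (2 * real m - 1) * b\<^sup>2) ^ m"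
proof -
  define f where "f k = real ((2 * m) choose k) * (b ^ k + (- b) ^ k) / 2 * a ^ (2 * m - k)" for k
  have "((a + b) ^ (2 * m) + (a - b) ^ (2 * m)) / 2 = ((b + a) ^ (2 * m) + (- b + a) ^ (2 * m)) / 2"
    by (simp add: add.commute)
  also have "\<dots> = (\<Sum>k\<le>2 * m. f k)"
    unfolding binomial_ring f_def
    by (simp add: sum.distrib[symmetric] sum_divide_distrib algebra_simps add_divide_distrib)
  also have "\<dots> = (\<Sum>j\<le>m. f (2 * j))"
    by (intro sum_even_indices) (simp add: f_def)
  also have "\<dots> \<le> (\<Sum>j\<le>m. real (m choose j) * ((2 * real m - 1) * b\<^sup>2) ^ j * (a\<^sup>2) ^ (m - j))"
  proof (intro sum_mono)
    fix j assume "j \<in> {..m}"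
    then have j: "j \<le> m" by simp
    have e: "2 * m - 2 * j = 2 * (m - j)" by simp
    have "f (2 * j) = real ((2 * m) choose (2 * j)) * ((b\<^sup>2) ^ j * (a\<^sup>2) ^ (m - j))"
      by (simp add: f_def e power_mult)
    also have "\<dots> \<le> real (m choose j) * (2 * real m - 1) ^ j * ((b\<^sup>2) ^ j * (a\<^sup>2) ^ (m - j))"
      using binomial_even_le[OF j] by (intro mult_right_mono) auto
    finally show "f (2 * j) \<le>
        real (m choose j) * ((2 * real m - 1) * b\<^sup>2) ^ j * (a\<^sup>2) ^ (m - j)"
      by (simp add: power_mult_distrib mult_ac)
  qed
  also have "\<dots> = ((2 * real m - 1) * b\<^sup>2 + a\<^sup>2) ^ m" by (simp add: binomial_ring)
  finally show ?thesis by (simp add: add.commute)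
qed

section \<open>Expansion of a Schatten power into words\<close>

lemma sum_bool_lists_Suc:
  fixes f :: "bool list \<Rightarrow> 'b :: comm_monoid_add"
  shows "(\<Sum>w | length w = Suc n. f w) = (\<Sum>w | length w = n. f (False # w) + f (True # w))"
proof -
  have fin: "finite {w :: bool list. length w = n}" for n
    using finite_lists_length_eq[of "UNIV :: bool set" n] by simp
  have "{w. length w = Suc n} = (#) False ` {w. length w = n} \<union> (#) True ` {w. length w = n}"
    by (auto simp: length_Suc_conv image_iff)
  then have "(\<Sum>w | length w = Suc n. f w) =
      (\<Sum>w\<in>(#) False ` {w. length w = n}. f w) + (\<Sum>w\<in>(#) True ` {w. length w = n}. f w)"
    by (simp only:) (rule sum.union_disjoint, auto simp: fin)
  then show ?thesis by (simp add: sum.reindex sum.distrib)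
qed

lemma mprod_alt_add:
  "mprod (alt n (A + B)) = (\<Sum>w | length w = n. mprod (aword w A B))"
proof (induction n arbitrary: A B)
  case (Suc n)
  show ?case
    by (simp add: Suc madj_add sum_bool_lists_Suc sum.distrib matrix_mult.add_left
        matrix_mult.sum_right)
qed simp

lemma sum_wt: "(\<Sum>w | length w = n. wt w a b) = (a + b) ^ n"
  by (induction n)
     (simp_all add: sum_bool_lists_Suc sum.distrib sum_distrib_left[symmetric] algebra_simps)

lemma schatten_pow_add_expand:
  "schatten_pow m (A + B) = (\<Sum>w | length w = 2 * m. Re (trace (mprod (aword w A B))))"
proof -
  have "complex_of_real (schatten_pow m (A + B)) =
      (\<Sum>w | length w = 2 * m. trace (mprod (aword w A B)))"
    unfolding trace_alt[symmetric] mprod_alt_add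
    by (rule linear_sum[OF bounded_linear.linear[OF bounded_linear_trace]])
  then have "Re (complex_of_real (schatten_pow m (A + B))) =
      Re (\<Sum>w | length w = 2 * m. trace (mprod (aword w A B)))" by simp
  then show ?thesis by simp
qed

text \<open>Words with an odd number of letters \<open>B\<close> cancel in the sum over \<open>\<plusminus>B\<close>; the remaining ones are
  bounded by their scalar counterparts.\<close>

lemma schatten_two_point_aux:
  assumes m: "m > 0" and pos: "a > 0" "b > 0"
    and A: "schatten_pow m A \<le> a ^ (2 * m)" and B: "schatten_pow m B \<le> b ^ (2 * m)"
  shows "(schatten_pow m (A + B) + schatten_pow m (A - B)) / 2
    \<le> (a\<^sup>2 + (2 * real m - 1) * b\<^sup>2) ^ m"
proof -
  let ?t = "\<lambda>w. Re (trace (mprod (aword w A B)))"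
  have minus: "Re (trace (mprod (aword w A (- B)))) = wt w 1 (- 1) * ?t w" for w
    using mprod_aword_scaleR[of w 1 A "- 1" B] by (simp add: trace_scaleR)
  \<comment> \<open>The factor \<open>1 + wt w 1 (- 1)\<close> is 2 or 0, according to the parity of
    the number of letters \<open>B\<close>.\<close>
  have "schatten_pow m (A + B) + schatten_pow m (A - B) =
      (\<Sum>w | length w = 2 * m. (1 + wt w 1 (- 1)) * ?t w)"
    using schatten_pow_add_expand[of m A B] schatten_pow_add_expand[of m A "- B"]
    by (simp add: minus sum.distrib[symmetric] algebra_simps)
  also have "\<dots> \<le> (\<Sum>w | length w = 2 * m. (1 + wt w 1 (- 1)) * wt w a b)"
  proof (intro sum_mono mult_left_mono)
    fix w :: "bool list" assume "w \<in> {w. length w = 2 * m}"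
    then have "cmod (trace (mprod (aword w A B))) \<le> wt w a b"
      using norm_trace_aword_le[OF m _ pos A B] by simp
    then show "?t w \<le> wt w a b" using complex_Re_le_cmod order.trans by blast
    show "0 \<le> 1 + wt w 1 (- 1)" using abs_wt_sign[of w] by linarith
  qed
  also have "\<dots> = (\<Sum>w | length w = 2 * m. wt w a b) + (\<Sum>w | length w = 2 * m. wt w a (- b))"
    using wt_mult[of _ 1 a "- 1" b] by (simp add: sum.distrib[symmetric] algebra_simps)
  also have "\<dots> = (a + b) ^ (2 * m) + (a - b) ^ (2 * m)" by (simp add: sum_wt)
  finally show ?thesis using even_part_power_le[of a b m] by simp
qed

text \<open>Restated with \<open>a\<close> and \<open>b\<close> bounding squared Schatten norms, the
  quantities in which the later recursion is linear, and extended to zero values by a limit.\<close>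

lemma schatten_two_point:
  assumes m: "m > 0" and nonneg: "a \<ge> 0" "b \<ge> 0"
    and A: "schatten_pow m A \<le> a ^ m" and B: "schatten_pow m B \<le> b ^ m"
  shows "(schatten_pow m (A + B) + schatten_pow m (A - B)) / 2 \<le> (a + (2 * real m - 1) * b) ^ m"
proof -
  have le: "(schatten_pow m (A + B) + schatten_pow m (A - B)) / 2
    \<le> ((a + e) + (2 * real m - 1) * (b + e)) ^ m" if "e > 0" for e
  proof -
    have "a ^ m \<le> sqrt (a + e) ^ (2 * m)" "b ^ m \<le> sqrt (b + e) ^ (2 * m)"
      using nonneg that by (simp_all add: power_mult power_mono)
    then have "schatten_pow m A \<le> sqrt (a + e) ^ (2 * m)" "schatten_pow m B \<le> sqrt (b + e) ^ (2 * m)"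
      using A B by linarith+
    from schatten_two_point_aux[OF m _ _ this] show ?thesis using nonneg that by simp
  qed
  have "isCont (\<lambda>e. ((a + e) + (2 * real m - 1) * (b + e)) ^ m) 0"
    by (intro continuous_intros)
  from le_if_le_at_right[OF this le] show ?thesis by simp
qed

text \<open>The graph of the power \<open>Suc k\<close> lies above its tangent at \<open>a\<close>.
  This serves as Young's inequality for traces and again as Jensen's inequality for the spectral
  norm.\<close>

lemma power_tangent_le:
  fixes a b :: real
  assumes "a \<ge> 0" "b \<ge> 0"
  shows "real (Suc k) * (a ^ k * b) \<le> real k * a ^ Suc k + b ^ Suc k"
proof (cases "a = 0")
  case False
  with assms have a: "a > 0" by simp
  have "1 + real (Suc k) * (b / a - 1) \<le> (1 + (b / a - 1)) ^ Suc k"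
    using assms by (intro Bernoulli_inequality) simp
  then have "(1 + real (Suc k) * (b / a - 1)) * a ^ Suc k \<le> (b / a) ^ Suc k * a ^ Suc k"
    using a by (intro mult_right_mono) auto
  also have "(b / a) ^ Suc k * a ^ Suc k = b ^ Suc k"
    using a by (simp add: power_divide)
  also have "(1 + real (Suc k) * (b / a - 1)) * a ^ Suc k =
      a ^ Suc k + real (Suc k) * (a ^ k * b) - real (Suc k) * a ^ Suc k"
    using a by (simp add: field_simps)
  finally show ?thesis by (simp add: algebra_simps)
qed (use assms in \<open>cases k; simp\<close>)

text \<open>Up to the factor \<open>2 * m\<close>, the product paired with \<open>B\<close> is the
  gradient of the Schatten power at \<open>A\<close>, so this is the tangent inequality that
  expresses its convexity. It follows from Hoelder for a word with a single letter
  \<open>B\<close>.\<close>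

lemma schatten_young:
  assumes m: "m > 0"
  shows "2 * real m * Re (trace (B ** mprod (alt (2 * m - 1) (madj A))))
    \<le> (2 * real m - 1) * schatten_pow m A + schatten_pow m B"
proof -
  define x where "x = root (2 * m) (schatten_pow m A)"
  define y where "y = root (2 * m) (schatten_pow m B)"
  have x: "x \<ge> 0" "x ^ (2 * m) = schatten_pow m A" and y: "y \<ge> 0" "y ^ (2 * m) = schatten_pow m B"
    using m by (simp_all add: x_def y_def)
  obtain k where k: "2 * m = Suc k" using m by (cases "2 * m") auto
  let ?t = "Re (trace (B ** mprod (alt k (madj A))))"
  have t: "?t \<le> a ^ k * b" if "x < a" "y < b" for a b
  proof -
    have "?t \<le> cmod (trace (mprod (aword (True # replicate k False) A B)))"
      by (simp add: aword_replicate_False complex_Re_le_cmod)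
    also have "\<dots> \<le> wt (True # replicate k False) a b"
      using that schatten_pow_root[OF m] k unfolding x_def y_def
      by (intro norm_trace_aword_le[OF m]) auto
    finally show ?thesis by (simp add: wt_replicate_False mult.commute)
  qed
  have t': "?t \<le> a ^ k * y" if "x < a" for a
    by (rule le_if_le_at_right[where f = "\<lambda>b. a ^ k * b", OF _ t[OF that]])
       (intro continuous_intros)
  have "?t \<le> x ^ k * y"
    by (rule le_if_le_at_right[where f = "\<lambda>a. a ^ k * y", OF _ t']) (intro continuous_intros)
  then have "real (Suc k) * ?t \<le> real (Suc k) * (x ^ k * y)" by (intro mult_left_mono) auto
  also have "\<dots> \<le> real k * x ^ Suc k + y ^ Suc k" using x y by (intro power_tangent_le)
  finally have "real (Suc k) * ?t \<le> real k * schatten_pow m A + schatten_pow m B"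
    using x y by (simp only: k)
  moreover have "real k = 2 * real m - 1" "2 * m - 1 = k" using k by auto
  ultimately show ?thesis by (simp add: algebra_simps)
qed

subsection \<open>Uniform smoothness\<close>

text \<open>Jensen for the m-th power at the points \<open>u / x\<close> and \<open>w / y\<close>
  with weights proportional to \<open>x\<close> and \<open>y\<close>. If \<open>x\<close> and
  \<open>y\<close> bound the two m-norms, integration gives Minkowski's inequality;
  \<open>x = y = 1 / 2\<close> gives midpoint convexity.\<close>

lemma power_weighted_add_le:
  fixes u w x y :: real
  assumes m: "m > 0" and "u \<ge> 0" "w \<ge> 0" and pos: "x > 0" "y > 0"
  shows "(u + w) ^ m \<le> (x + y) ^ (m - 1) * (x / x ^ m * u ^ m + y / y ^ m * w ^ m)"
proof -
  have conv: "convex_on {0..} (\<lambda>x :: real. x ^ m)"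
  proof (cases "even m")
    case True
    then show ?thesis by (intro convex_on_subset[OF convex_power_even]) auto
  qed (rule convex_power_odd)
  define r where "r = y / (x + y)"
  have r: "0 \<le> r" "r \<le> 1" "1 - r = x / (x + y)" using pos by (simp_all add: r_def field_simps)
  have "((1 - r) * (u / x) + r * (w / y)) ^ m \<le> (1 - r) * (u / x) ^ m + r * (w / y) ^ m"
    using convex_onD[OF conv r(1,2), of "u / x" "w / y"] assms by simp
  also have "(1 - r) * (u / x) + r * (w / y) = (u + w) / (x + y)"
    unfolding r(3) using pos by (simp add: r_def add_divide_distrib)
  finally have "((u + w) / (x + y)) ^ m * (x + y) ^ m \<le>
      ((1 - r) * (u / x) ^ m + r * (w / y) ^ m) * (x + y) ^ m"
    using pos by (intro mult_right_mono) auto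
  also have "((u + w) / (x + y)) ^ m * (x + y) ^ m = (u + w) ^ m"
    using pos by (simp add: power_divide)
  also have "(x + y) ^ m = (x + y) ^ (m - 1) * (x + y)" using m by (cases m) auto
  also have "((1 - r) * (u / x) ^ m + r * (w / y) ^ m) * ((x + y) ^ (m - 1) * (x + y)) =
      (x + y) ^ (m - 1) * (((1 - r) * (x + y)) * (u / x) ^ m + (r * (x + y)) * (w / y) ^ m)"
    by (simp add: algebra_simps)
  also have "(1 - r) * (x + y) = x" unfolding r(3) using pos by simp
  also have "r * (x + y) = y" unfolding r_def using pos by simp
  finally show ?thesis by (simp add: power_divide)
qed

lemma (in prob_space) minkowski_power:
  fixes f g :: "'a \<Rightarrow> real"
  assumes m: "m > 0" and nonneg: "\<And>\<omega>. f \<omega> \<ge> 0" "\<And>\<omega>. g \<omega> \<ge> 0" "x \<ge> 0" "y \<ge> 0"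
    and int: "integrable M (\<lambda>\<omega>. f \<omega> ^ m)" "integrable M (\<lambda>\<omega>. g \<omega> ^ m)"
    and le: "expectation (\<lambda>\<omega>. f \<omega> ^ m) \<le> x ^ m" "expectation (\<lambda>\<omega>. g \<omega> ^ m) \<le> y ^ m"
  shows "expectation (\<lambda>\<omega>. (f \<omega> + g \<omega>) ^ m) \<le> (x + y) ^ m"
proof -
  \<comment> \<open>The shift by \<open>e\<close> keeps the weights positive when \<open>x\<close>
    or \<open>y\<close> is zero.\<close>
  have *: "expectation (\<lambda>\<omega>. (f \<omega> + g \<omega>) ^ m) \<le> ((x + e) + (y + e)) ^ m" if e: "e > 0" for e
  proof -
    define x' where "x' = x + e"
    define y' where "y' = y + e"
    have pos: "x' > 0" "y' > 0" using nonneg e by (simp_all add: x'_def y'_def)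
    have le': "expectation (\<lambda>\<omega>. f \<omega> ^ m) \<le> x' ^ m" "expectation (\<lambda>\<omega>. g \<omega> ^ m) \<le> y' ^ m"
      using le power_mono[of x x' m] power_mono[of y y' m] nonneg e
      by (auto simp: x'_def y'_def)
    have "expectation (\<lambda>\<omega>. (f \<omega> + g \<omega>) ^ m) \<le>
        expectation (\<lambda>\<omega>. (x' + y') ^ (m - 1) *
          (x' / x' ^ m * f \<omega> ^ m + y' / y' ^ m * g \<omega> ^ m))"
      using int pos nonneg
      by (intro integral_mono' power_weighted_add_le m) auto
    also have "\<dots> = (x' + y') ^ (m - 1) * (x' / x' ^ m * expectation (\<lambda>\<omega>. f \<omega> ^ m)
        + y' / y' ^ m * expectation (\<lambda>\<omega>. g \<omega> ^ m))"
      using int by simp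
    also have "\<dots> \<le> (x' + y') ^ (m - 1) * (x' / x' ^ m * x' ^ m + y' / y' ^ m * y' ^ m)"
      using pos le' by (intro mult_left_mono add_mono) auto
    also have "\<dots> = (x' + y') ^ m" using pos m by (cases m) auto
    finally show ?thesis by (simp add: x'_def y'_def)
  qed
  have "isCont (\<lambda>e. ((x + e) + (y + e)) ^ m) 0" by (intro continuous_intros)
  from le_if_le_at_right[OF this *] show ?thesis by simp
qed

lemma (in prob_space) integrable_continuous_bounded:
  fixes Y :: "'a \<Rightarrow> 'b :: euclidean_space" and g :: "'b \<Rightarrow> 'c :: {banach, second_countable_topology}"
  assumes Y[measurable]: "Y \<in> borel_measurable M" and bound: "AE \<omega> in M. norm (Y \<omega>) \<le> K"
    and g: "continuous_on UNIV g"
  shows "integrable M (\<lambda>\<omega>. g (Y \<omega>))"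
proof -
  have "compact (g ` cball 0 K)"
    using g by (intro compact_continuous_image continuous_on_subset[OF g]) auto
  then obtain c where c: "\<And>x. x \<in> g ` cball 0 K \<Longrightarrow> norm x \<le> c"
    using compact_imp_bounded bounded_iff by metis
  show ?thesis
  proof (rule integrable_const_bound)
    show "AE \<omega> in M. norm (g (Y \<omega>)) \<le> c"
      using bound by eventually_elim (auto intro!: c)
    show "(\<lambda>\<omega>. g (Y \<omega>)) \<in> borel_measurable M"
      using borel_measurable_continuous_onI[OF g] by measurable
  qed
qed

text \<open>The function \<open>\<phi> t = (E tr |A + t Y|^2m)^(1/m)\<close> satisfies
  \<open>\<phi> (t + s) + \<phi> (t - s) \<le> 2 \<phi> t + 2 (2m - 1) b s\<^sup>2\<close> by the two-point inequality, and
  \<open>\<phi> (- s) \<ge> \<phi> 0\<close> because \<open>Y\<close> is centred.  Summing over a grid of mesh \<open>1/N\<close> and letting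
  \<open>N\<close> tend to infinity gives \<open>\<phi> 1 \<le> \<phi> 0 + (2m - 1) b\<close> with the sharp constant.\<close>

lemma (in prob_space) schatten_smoothness:
  fixes Y :: "'a \<Rightarrow> complex ^ 'd ^ 'd"
  assumes m: "m > 0" and b: "b \<ge> 0"
    and Y: "Y \<in> borel_measurable M" and bound: "AE \<omega> in M. norm (Y \<omega>) \<le> K"
    and le: "AE \<omega> in M. schatten_pow m (Y \<omega>) \<le> b ^ m"
    and centred: "expectation Y = 0"
  shows "expectation (\<lambda>\<omega>. schatten_pow m (A + Y \<omega>))
    \<le> (root m (schatten_pow m A) + (2 * real m - 1) * b) ^ m"
proof -
  define c where "c = (2 * real m - 1) * b"
  define F where "F t \<omega> = schatten_pow m (A + t *\<^sub>R Y \<omega>)" for t \<omega>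
  define \<phi> where "\<phi> t = root m (expectation (F t))" for t
  have m1: "2 * real m - 1 \<ge> 0" and c: "c \<ge> 0" using m b by (auto simp: c_def)
  note integrableI = integrable_continuous_bounded[OF Y bound]
  have cont_F: "continuous_on UNIV (\<lambda>y. schatten_pow m (A + t *\<^sub>R y))" for t
    by (rule continuous_on_compose2[OF continuous_on_schatten_pow])
       (auto intro!: continuous_intros)
  have int_F: "integrable M (F t)" for t
    unfolding F_def by (rule integrableI[OF cont_F])
  have F0: "F 0 = (\<lambda>_. schatten_pow m A)" and F1: "F 1 = (\<lambda>\<omega>. schatten_pow m (A + Y \<omega>))"
    by (simp_all add: F_def fun_eq_iff)
  have F_nonneg: "F t \<omega> \<ge> 0" for t \<omega> by (simp add: F_def)
  have EF: "\<phi> t ^ m = expectation (F t)" and \<phi>_nonneg: "\<phi> t \<ge> 0" for t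
    using m by (simp_all add: \<phi>_def F_nonneg)
  \<comment> \<open>The two-point inequality is averaged over \<open>Y\<close>. Its error
    \<open>k\<close> is a constant, because \<open>b\<close> bounds \<open>Y\<close> almost surely,
    so Minkowski adds it outside the expectation.\<close>
  have midpoint: "\<phi> (t + s) + \<phi> (t - s) \<le> 2 * \<phi> t + 2 * c * s\<^sup>2" for t s
  proof -
    define k where "k = c * s\<^sup>2"
    have k: "k \<ge> 0" using c by (simp add: k_def)
    have int_k: "integrable M (\<lambda>\<omega>. (root m (F t \<omega>) + k) ^ m)"
      unfolding F_def
      by (rule integrableI) (intro continuous_on_power continuous_on_add continuous_on_const
          continuous_on_real_root cont_F)
    have "(expectation (F (t + s)) + expectation (F (t - s))) / 2 =
        expectation (\<lambda>\<omega>. (F (t + s) \<omega> + F (t - s) \<omega>) / 2)"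
      using int_F by simp
    also have "\<dots> \<le> expectation (\<lambda>\<omega>. (root m (F t \<omega>) + k) ^ m)"
    proof (rule integral_mono_AE)
      show "AE \<omega> in M. (F (t + s) \<omega> + F (t - s) \<omega>) / 2 \<le> (root m (F t \<omega>) + k) ^ m"
        using le
      proof eventually_elim
        case (elim \<omega>)
        have "schatten_pow m (s *\<^sub>R Y \<omega>) \<le> (s\<^sup>2 * b) ^ m"
          using elim by (simp add: schatten_pow_scaleR power_mult_distrib power_mult mult_left_mono)
        moreover have "schatten_pow m (A + t *\<^sub>R Y \<omega>) \<le> root m (F t \<omega>) ^ m"
          using m by (simp add: F_def)
        ultimately have "(schatten_pow m (A + t *\<^sub>R Y \<omega> + s *\<^sub>R Y \<omega>)
            + schatten_pow m (A + t *\<^sub>R Y \<omega> - s *\<^sub>R Y \<omega>)) / 2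
            \<le> (root m (F t \<omega>) + (2 * real m - 1) * (s\<^sup>2 * b)) ^ m"
          using m b F_nonneg by (intro schatten_two_point) auto
        then show ?case
          by (simp add: F_def k_def c_def scaleR_add_left scaleR_diff_left algebra_simps)
      qed
    qed (use int_F int_k in simp_all)
    also have "\<dots> \<le> (\<phi> t + k) ^ m"
      using m k F_nonneg \<phi>_nonneg int_F
      by (intro minkowski_power) (auto simp: EF prob_space)
    finally have "(\<phi> (t + s) ^ m + \<phi> (t - s) ^ m) / 2 \<le> (\<phi> t + k) ^ m" by (simp add: EF)
    \<comment> \<open>Convexity trades the mean of the powers for the power of the mean, after which
      m-th roots can be compared.\<close>
    moreover have "((\<phi> (t + s) + \<phi> (t - s)) / 2) ^ m \<le> (\<phi> (t + s) ^ m + \<phi> (t - s) ^ m) / 2"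
    proof -
      have "(\<phi> (t + s) / 2 + \<phi> (t - s) / 2) ^ m \<le> (1 / 2 + 1 / 2) ^ (m - 1) *
          (1 / 2 / (1 / 2) ^ m * (\<phi> (t + s) / 2) ^ m + 1 / 2 / (1 / 2) ^ m * (\<phi> (t - s) / 2) ^ m)"
        using m \<phi>_nonneg by (intro power_weighted_add_le) auto
      then show ?thesis by (simp add: power_divide add_divide_distrib)
    qed
    ultimately have "((\<phi> (t + s) + \<phi> (t - s)) / 2) ^ m \<le> (\<phi> t + k) ^ m" by linarith
    then have "(\<phi> (t + s) + \<phi> (t - s)) / 2 \<le> \<phi> t + k"
      using m k \<phi>_nonneg by (subst (asm) power_mono_iff) (auto intro!: add_nonneg_nonneg)
    then show ?thesis by (simp add: k_def)
  qed
  have lower: "\<phi> 0 \<le> \<phi> s" for s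
  proof -
    \<comment> \<open>\<open>V\<close> is the gradient direction at \<open>A\<close>. In the tangent
      inequality \<open>s *\<^sub>R Y \<omega>\<close> enters the trace side linearly, so it
      disappears on integration.\<close>
    define V where "V = mprod (alt (2 * m - 1) (madj A))"
    have lin: "bounded_linear (\<lambda>B. Re (trace (B ** V)))"
      by (intro bounded_linear_compose[OF bounded_linear_Re]
          bounded_linear_compose[OF bounded_linear_trace] matrix_mult.bounded_linear_left)
    have intY: "integrable M Y"
      by (rule integrableI[of "\<lambda>y. y"]) (rule continuous_on_id)
    have AV: "Re (trace (A ** V)) = schatten_pow m A"
    proof -
      have eq: "A ** V = mprod (alt (2 * m) A)" using m by (cases "2 * m") (auto simp: V_def)
      show ?thesis unfolding eq trace_alt by simp
    qed
    have tr: "Re (trace ((A + s *\<^sub>R Y \<omega>) ** V)) =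
        schatten_pow m A + s * Re (trace (Y \<omega> ** V))" for \<omega>
      by (simp add: matrix_mult.add_left matrix_mult.scaleR_left trace_add trace_scaleR AV)
    have int_t: "integrable M (\<lambda>\<omega>. Re (trace (Y \<omega> ** V)))"
      by (rule integrable_bounded_linear[OF lin intY])
    have "expectation (\<lambda>\<omega>. Re (trace (Y \<omega> ** V))) = 0"
      using integral_bounded_linear[OF lin intY] linear_0[OF bounded_linear.linear[OF lin]] centred by simp
    then have "2 * real m * schatten_pow m A =
        expectation (\<lambda>\<omega>. 2 * real m * Re (trace ((A + s *\<^sub>R Y \<omega>) ** V)))"
      using int_t by (simp add: tr prob_space)
    also have "\<dots> \<le> expectation (\<lambda>\<omega>. (2 * real m - 1) * schatten_pow m A + F s \<omega>)"
    proof (rule integral_mono)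
      show "integrable M (\<lambda>\<omega>. 2 * real m * Re (trace ((A + s *\<^sub>R Y \<omega>) ** V)))"
        using int_t by (simp add: tr)
      show "integrable M (\<lambda>\<omega>. (2 * real m - 1) * schatten_pow m A + F s \<omega>)"
        using int_F by simp
      show "2 * real m * Re (trace ((A + s *\<^sub>R Y \<omega>) ** V)) \<le>
          (2 * real m - 1) * schatten_pow m A + F s \<omega>" for \<omega>
        unfolding F_def V_def by (rule schatten_young[OF m])
    qed
    also have "\<dots> = (2 * real m - 1) * schatten_pow m A + expectation (F s)"
      using int_F by (simp add: prob_space)
    finally have "schatten_pow m A \<le> expectation (F s)" by (simp add: algebra_simps)
    then show ?thesis using m by (simp add: \<phi>_def F0 prob_space)
  qed
  \<comment> \<open>The one-step case \<open>N = 0\<close> gives the constant \<open>2 * c\<close>;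
    refining the grid removes the factor 2.\<close>
  have grid: "\<phi> 1 \<le> \<phi> 0 + c * (1 + 1 / real (Suc N))" for N
  proof -
    define h where "h = 1 / real (Suc N)"
    \<comment> \<open>Consecutive increments grow by at most \<open>2 * c * h\<^sup>2\<close>. The
      first one is controlled because \<open>\<phi> (- h)\<close> is at least
      \<open>\<phi> 0\<close>.\<close>
    have step: "\<phi> (real (Suc k) * h) - \<phi> (real k * h) \<le> 2 * c * h\<^sup>2 * real (Suc k)" for k
    proof (induction k)
      case 0
      show ?case using midpoint[of 0 h] lower[of "- h"] by simp
    next
      case (Suc k)
      have "\<phi> (real (Suc (Suc k)) * h) + \<phi> (real k * h)
          \<le> 2 * \<phi> (real (Suc k) * h) + 2 * c * h\<^sup>2"
        using midpoint[of "real (Suc k) * h" h] by (simp add: algebra_simps)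
      with Suc show ?case by (simp add: algebra_simps)
    qed
    have "\<phi> (real k * h) \<le> \<phi> 0 + c * h\<^sup>2 * (real k * (real k + 1))" for k
    proof (induction k)
      case (Suc k)
      with step[of k] show ?case by (simp add: algebra_simps)
    qed simp
    from this[of "Suc N"] have "\<phi> 1 \<le> \<phi> 0 + c * h\<^sup>2 * (real (Suc N) * (real (Suc N) + 1))"
      by (simp add: h_def)
    also have "c * h\<^sup>2 * (real (Suc N) * (real (Suc N) + 1)) = c * (1 + h)"
      unfolding h_def by (simp add: divide_simps power2_eq_square del: of_nat_Suc)
    finally show ?thesis by (simp add: h_def)
  qed
  have "(\<lambda>N. 1 / real (Suc N)) \<longlonglongrightarrow> 0" by (rule LIMSEQ_Suc[OF lim_1_over_n])
  then have "(\<lambda>N. \<phi> 0 + c * (1 + 1 / real (Suc N))) \<longlonglongrightarrow> \<phi> 0 + c * (1 + 0)"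
    by (intro tendsto_intros)
  then have "\<phi> 1 \<le> \<phi> 0 + c * (1 + 0)"
    by (rule LIMSEQ_le_const) (use grid in blast)
  then have "\<phi> 1 ^ m \<le> (\<phi> 0 + c) ^ m" using \<phi>_nonneg by (intro power_mono) auto
  moreover have "\<phi> 0 = root m (schatten_pow m A)" by (simp add: \<phi>_def F0 prob_space)
  ultimately show ?thesis by (simp add: EF F1 c_def)
qed

subsection \<open>Products of independent perturbations of the identity\<close>

lemma schatten_pow_0: "m > 0 \<Longrightarrow> schatten_pow m 0 = 0"
  using schatten_pow_scaleR[of m 0 0] by (simp add: power_0_left)

lemma norm_le_spectral:
  fixes A :: "complex ^ 'd ^ 'd"
  shows "norm A \<le> spectral_norm A * norm (mat 1 :: complex ^ 'd ^ 'd)"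
  using norm_mult_le_spectral[of A "mat 1"] by simp

lemma norm_matrix_mult_le:
  fixes A B :: "complex ^ 'd ^ 'd"
  shows "norm (A ** B) \<le> norm A * norm B"
  using norm_mult_le_spectral[of A B] mult_right_mono[OF spectral_norm_le_norm[of A], of "norm B"]
  by simp

text \<open>Conditioning on \<open>P\<close> without conditional expectations: the joint law is a
  product measure, so by Fubini one may freeze \<open>P\<close> and integrate over \<open>W\<close>
  alone.\<close>

lemma (in prob_space) expectation_indep_var:
  fixes P W :: "'a \<Rightarrow> 'b :: euclidean_space"
    and h :: "'b \<times> 'b \<Rightarrow> 'c :: {banach, second_countable_topology}"
  assumes ind: "indep_var borel P borel W"
    and h: "h \<in> borel_measurable (borel \<Otimes>\<^sub>M borel)"
    and int: "integrable M (\<lambda>\<omega>. h (P \<omega>, W \<omega>))"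
  shows "expectation (\<lambda>\<omega>. h (P \<omega>, W \<omega>)) = expectation (\<lambda>\<omega>. expectation (\<lambda>\<omega>'. h (P \<omega>, W \<omega>')))"
    and "integrable M (\<lambda>\<omega>. expectation (\<lambda>\<omega>'. h (P \<omega>, W \<omega>')))"
proof -
  have [measurable]: "P \<in> borel_measurable M" "W \<in> borel_measurable M"
    using indep_var_rv1[OF ind] indep_var_rv2[OF ind] by auto
  note h[measurable]
  let ?DP = "distr M borel P" and ?DW = "distr M borel W"
  interpret DP: prob_space ?DP by (rule prob_space_distr) simp
  interpret DW: prob_space ?DW by (rule prob_space_distr) simp
  interpret pair_sigma_finite ?DP ?DW ..
  have eq: "?DP \<Otimes>\<^sub>M ?DW = distr M (borel \<Otimes>\<^sub>M borel) (\<lambda>\<omega>. (P \<omega>, W \<omega>))"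
    using ind unfolding indep_var_distribution_eq by auto
  have int': "integrable (?DP \<Otimes>\<^sub>M ?DW) h"
    unfolding eq by (subst integrable_distr_eq) (use int in auto)
  have inner: "integral\<^sup>L ?DW (\<lambda>w. h (p, w)) = expectation (\<lambda>\<omega>'. h (p, W \<omega>'))" for p
    by (subst integral_distr) (auto intro: measurable_compose[OF _ h])
  have "(\<lambda>p. integral\<^sup>L ?DW (\<lambda>w. h (p, w))) \<in> borel_measurable ?DP"
    by measurable
  then have meas: "(\<lambda>p. expectation (\<lambda>\<omega>'. h (p, W \<omega>'))) \<in> borel_measurable borel"
    unfolding inner by simp
  have "expectation (\<lambda>\<omega>. h (P \<omega>, W \<omega>)) = integral\<^sup>L (?DP \<Otimes>\<^sub>M ?DW) h"
    unfolding eq by (subst integral_distr) auto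
  also have "\<dots> = integral\<^sup>L ?DP (\<lambda>p. integral\<^sup>L ?DW (\<lambda>w. h (p, w)))"
    using integral_fst'[OF int'] by simp
  also have "\<dots> = expectation (\<lambda>\<omega>. expectation (\<lambda>\<omega>'. h (P \<omega>, W \<omega>')))"
    unfolding inner using meas by (subst integral_distr) auto
  finally show "expectation (\<lambda>\<omega>. h (P \<omega>, W \<omega>)) =
    expectation (\<lambda>\<omega>. expectation (\<lambda>\<omega>'. h (P \<omega>, W \<omega>')))" .
  have "integrable ?DP (\<lambda>p. integral\<^sup>L ?DW (\<lambda>w. h (p, w)))"
    using integrable_fst'[OF int'] .
  then show "integrable M (\<lambda>\<omega>. expectation (\<lambda>\<omega>'. h (P \<omega>, W \<omega>')))"
    unfolding inner by (subst (asm) integrable_distr_eq) (use meas in auto)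
qed

lemma continuous_on_factor_mult:
  "continuous_on UNIV (\<lambda>z :: (complex ^ 'd ^ 'd) \<times> (complex ^ 'd ^ 'd). (mat 1 + snd z) ** fst z)"
  by (intro matrix_mult.continuous_on continuous_intros)

lemma borel_measurable_pair_continuous:
  fixes h :: "'b :: euclidean_space \<times> 'b \<Rightarrow> 'c :: topological_space"
  assumes "continuous_on UNIV h"
  shows "h \<in> borel_measurable (borel \<Otimes>\<^sub>M borel)"
  unfolding borel_prod by (rule borel_measurable_continuous_onI[OF assms])

lemma (in prob_space) AE_norm_le_of_spectral:
  fixes W :: "'a \<Rightarrow> complex ^ 'd ^ 'd"
  assumes "AE \<omega> in M. spectral_norm (W \<omega> - C) \<le> \<sigma>"
  shows "AE \<omega> in M. norm (W \<omega>) \<le> \<sigma> * norm (mat 1 :: complex ^ 'd ^ 'd) + norm C"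
  using assms
proof eventually_elim
  case (elim \<omega>)
  have "norm (W \<omega>) \<le> norm (W \<omega> - C) + norm C" using norm_triangle_sub[of "W \<omega>" C] by simp
  also have "norm (W \<omega> - C) \<le> \<sigma> * norm (mat 1 :: complex ^ 'd ^ 'd)"
    using norm_le_spectral[of "W \<omega> - C"] elim
    by (meson mult_right_mono norm_ge_zero order.trans)
  finally show ?case by simp
qed

lemma (in prob_space) AE_bound_nonneg:
  assumes "AE \<omega> in M. spectral_norm (W \<omega>) \<le> \<sigma>"
  shows "0 \<le> \<sigma>"
proof -
  have "AE \<omega> in M. 0 \<le> \<sigma>"
    using assms by eventually_elim (meson order.trans spectral_norm_nonneg)
  then show ?thesis by simp
qed

lemma root_schatten_pow_mult_le:
  assumes m: "m > 0" and "spectral_norm B \<le> \<beta>"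
  shows "root m (schatten_pow m (B ** A)) \<le> \<beta>\<^sup>2 * root m (schatten_pow m A)"
proof -
  have "schatten_pow m (B ** A) \<le> spectral_norm B ^ (2 * m) * schatten_pow m A"
    by (rule schatten_pow_mult_le[OF m])
  also have "\<dots> \<le> \<beta> ^ (2 * m) * schatten_pow m A"
    using assms by (intro mult_right_mono power_mono) auto
  finally have "root m (schatten_pow m (B ** A)) \<le> root m ((\<beta>\<^sup>2) ^ m * schatten_pow m A)"
    using m by (simp add: power_mult)
  also have "\<dots> = \<beta>\<^sup>2 * root m (schatten_pow m A)"
    using m by (simp add: real_root_mult real_root_power_cancel)
  finally show ?thesis .
qed

text \<open>One new factor with the past frozen. The mean of the factor acts on \<open>D\<close>,
  the centred noise on \<open>p\<close>; keeping the two matrices apart allows \<open>D\<close> to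
  be a deviation while \<open>p\<close> is the full product.\<close>

lemma (in prob_space) schatten_factor_le:
  fixes W :: "'a \<Rightarrow> complex ^ 'd ^ 'd"
  assumes m: "m > 0" and W[measurable]: "W \<in> borel_measurable M"
    and mean: "spectral_norm (expectation W) \<le> \<xi>"
    and dev: "AE \<omega> in M. spectral_norm (W \<omega> - expectation W) \<le> \<sigma>"
  shows "expectation (\<lambda>\<omega>. schatten_pow m ((mat 1 + expectation W) ** D + (W \<omega> - expectation W) ** p))
    \<le> ((1 + \<xi>)\<^sup>2 * root m (schatten_pow m D)
        + (2 * real m - 1) * (\<sigma>\<^sup>2 * root m (schatten_pow m p))) ^ m"
proof -
  let ?Y = "\<lambda>\<omega>. (W \<omega> - expectation W) ** p"
  have \<sigma>: "\<sigma> \<ge> 0" using AE_bound_nonneg[OF dev] .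
  have bdW: "AE \<omega> in M. norm (W \<omega>) \<le> \<sigma> * norm (mat 1 :: complex ^ 'd ^ 'd) + norm (expectation W)"
    by (rule AE_norm_le_of_spectral[OF dev])
  have intW: "integrable M W"
    using integrable_continuous_bounded[OF W bdW continuous_on_id] by simp
  have contY: "continuous_on UNIV (\<lambda>w. (w - expectation W) ** p)"
    by (intro matrix_mult.continuous_on continuous_intros)
  have measY: "?Y \<in> borel_measurable M"
    using measurable_compose[OF W borel_measurable_continuous_onI[OF contY]] .
  have bdY: "AE \<omega> in M. norm (?Y \<omega>) \<le> \<sigma> * norm p"
    using dev
  proof eventually_elim
    case (elim \<omega>)
    then show ?case
      using norm_mult_le_spectral[of "W \<omega> - expectation W" p]
      by (meson mult_right_mono norm_ge_zero order.trans)
  qed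
  have schY: "AE \<omega> in M. schatten_pow m (?Y \<omega>) \<le> (\<sigma>\<^sup>2 * root m (schatten_pow m p)) ^ m"
    using dev
  proof eventually_elim
    case (elim \<omega>)
    have "root m (schatten_pow m (?Y \<omega>)) ^ m \<le> (\<sigma>\<^sup>2 * root m (schatten_pow m p)) ^ m"
      using m by (intro power_mono root_schatten_pow_mult_le elim) simp_all
    then show ?case using m by simp
  qed
  have "expectation (\<lambda>\<omega>. W \<omega> - expectation W) = 0"
    using intW by (simp add: prob_space)
  then have centred: "expectation ?Y = 0"
    using integral_bounded_linear[OF matrix_mult.bounded_linear_left[of p],
        of M "\<lambda>\<omega>. W \<omega> - expectation W"] intW by simp
  have "expectation (\<lambda>\<omega>. schatten_pow m ((mat 1 + expectation W) ** D + ?Y \<omega>))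
      \<le> (root m (schatten_pow m ((mat 1 + expectation W) ** D))
        + (2 * real m - 1) * (\<sigma>\<^sup>2 * root m (schatten_pow m p))) ^ m"
    using m by (intro schatten_smoothness[OF m _ measY bdY schY centred]) simp
  also have "\<dots> \<le> ((1 + \<xi>)\<^sup>2 * root m (schatten_pow m D)
        + (2 * real m - 1) * (\<sigma>\<^sup>2 * root m (schatten_pow m p))) ^ m"
  proof (intro power_mono add_right_mono root_schatten_pow_mult_le m)
    show "spectral_norm (mat 1 + expectation W) \<le> 1 + \<xi>"
      using spectral_norm_add_le[of "mat 1" "expectation W"] spectral_norm_mat_1_le[where 'd = 'd]
        mean by linarith
  qed (use m in \<open>auto intro!: add_nonneg_nonneg mult_nonneg_nonneg\<close>)
  finally show ?thesis .
qed

text \<open>The case \<open>c = 0\<close> controls the growth of the product, the case \<open>c = E P\<close> its fluctuation.\<close>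

lemma (in prob_space) schatten_product_step:
  fixes P W :: "'a \<Rightarrow> complex ^ 'd ^ 'd"
  assumes m: "m > 0" and ind: "indep_var borel P borel W"
    and bdP: "AE \<omega> in M. norm (P \<omega>) \<le> K"
    and mean: "spectral_norm (expectation W) \<le> \<xi>"
    and dev: "AE \<omega> in M. spectral_norm (W \<omega> - expectation W) \<le> \<sigma>"
    and gh: "g \<ge> 0" "h \<ge> 0"
    and g: "expectation (\<lambda>\<omega>. schatten_pow m (P \<omega> - c)) \<le> g ^ m"
    and h: "expectation (\<lambda>\<omega>. schatten_pow m (P \<omega>)) \<le> h ^ m"
  shows "expectation (\<lambda>\<omega>. schatten_pow m ((mat 1 + W \<omega>) ** P \<omega> - (mat 1 + expectation W) ** c))
    \<le> ((1 + \<xi>)\<^sup>2 * g + (2 * real m - 1) * (\<sigma>\<^sup>2 * h)) ^ m"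
proof -
  have [measurable]: "P \<in> borel_measurable M" "W \<in> borel_measurable M"
    using indep_var_rv1[OF ind] indep_var_rv2[OF ind] by auto
  let ?C = "2 * real m - 1"
  have C: "?C \<ge> 0" using m by simp
  note bdW = AE_norm_le_of_spectral[OF dev]
  define k where "k = (\<lambda>(p, w). schatten_pow m ((mat 1 + w) ** p - (mat 1 + expectation W) ** c))"
  have cont_k: "continuous_on UNIV k"
    unfolding k_def case_prod_unfold
    by (rule continuous_on_compose2[OF continuous_on_schatten_pow])
       (auto intro!: continuous_on_diff continuous_on_factor_mult continuous_on_const)
  define K' where "K' = K + (\<sigma> * norm (mat 1 :: complex ^ 'd ^ 'd) + norm (expectation W))"
  have bdPW: "AE \<omega> in M. norm (P \<omega>, W \<omega>) \<le> K'"
    using bdP bdW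
  proof eventually_elim
    case (elim \<omega>)
    then show ?case using norm_Pair_le[of "P \<omega>" "W \<omega>"] by (simp add: K'_def)
  qed
  have "(\<lambda>\<omega>. (P \<omega>, W \<omega>)) \<in> borel_measurable M"
    unfolding borel_prod[symmetric] by measurable
  from integrable_continuous_bounded[OF this bdPW cont_k]
  have int_k: "integrable M (\<lambda>\<omega>. k (P \<omega>, W \<omega>))" .
  note fubini = expectation_indep_var[OF ind borel_measurable_pair_continuous[OF cont_k] int_k]
  define f1 where "f1 p = (1 + \<xi>)\<^sup>2 * root m (schatten_pow m (p - c))" for p
  define f2 where "f2 p = ?C * (\<sigma>\<^sup>2 * root m (schatten_pow m p))" for p :: "complex ^ 'd ^ 'd"
  have cont_f: "continuous_on UNIV f1" "continuous_on UNIV f2"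
    unfolding f1_def f2_def
    by (intro continuous_on_mult continuous_on_const continuous_on_real_root
        continuous_on_compose2[OF continuous_on_schatten_pow] continuous_on_diff
        continuous_on_id subset_UNIV)+
  have nonneg_f: "f1 p \<ge> 0" "f2 p \<ge> 0" for p
    using C m by (simp_all add: f1_def f2_def)
  note integrableP = integrable_continuous_bounded[OF \<open>P \<in> borel_measurable M\<close> bdP]
  have inner: "expectation (\<lambda>\<omega>'. k (p, W \<omega>')) \<le> (f1 p + f2 p) ^ m" for p
  proof -
    \<comment> \<open>The deviation \<open>p - c\<close> is carried on by the mean factor, while the
      noise multiplies all of \<open>p\<close>. This is why both bounds \<open>g\<close> and
      \<open>h\<close> occur in the conclusion.\<close>
    have "(mat 1 + w) ** p - (mat 1 + expectation W) ** c =
        (mat 1 + expectation W) ** (p - c) + (w - expectation W) ** p" for w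
      by (simp add: matrix_mult.add_left matrix_mult.diff_left matrix_mult.diff_right)
    then show ?thesis
      using schatten_factor_le[OF m _ mean dev, of "p - c" p]
      by (simp add: k_def f1_def f2_def)
  qed
  have "expectation (\<lambda>\<omega>. k (P \<omega>, W \<omega>)) = expectation (\<lambda>\<omega>. expectation (\<lambda>\<omega>'. k (P \<omega>, W \<omega>')))"
    by (rule fubini(1))
  also have "\<dots> \<le> expectation (\<lambda>\<omega>. (f1 (P \<omega>) + f2 (P \<omega>)) ^ m)"
    by (intro integral_mono fubini(2) inner
        integrableP[of "\<lambda>p. (f1 p + f2 p) ^ m"] continuous_intros cont_f)
  also have "\<dots> \<le> ((1 + \<xi>)\<^sup>2 * g + ?C * (\<sigma>\<^sup>2 * h)) ^ m"
  proof (rule minkowski_power[OF m])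
    show "integrable M (\<lambda>\<omega>. f1 (P \<omega>) ^ m)" "integrable M (\<lambda>\<omega>. f2 (P \<omega>) ^ m)"
      by (intro integrableP[of "\<lambda>p. f1 p ^ m"] integrableP[of "\<lambda>p. f2 p ^ m"]
          continuous_intros cont_f)+
    have "f1 p ^ m = ((1 + \<xi>)\<^sup>2) ^ m * schatten_pow m (p - c)" for p
      using m by (simp add: f1_def power_mult_distrib)
    then show "expectation (\<lambda>\<omega>. f1 (P \<omega>) ^ m) \<le> ((1 + \<xi>)\<^sup>2 * g) ^ m"
      using g by (simp add: power_mult_distrib mult_left_mono)
    have "f2 p ^ m = (?C * \<sigma>\<^sup>2) ^ m * schatten_pow m p" for p
      using m by (simp add: f2_def power_mult_distrib)
    then have "expectation (\<lambda>\<omega>. f2 (P \<omega>) ^ m) \<le> (?C * \<sigma>\<^sup>2) ^ m * h ^ m"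
      using h C by (simp add: mult_left_mono)
    then show "expectation (\<lambda>\<omega>. f2 (P \<omega>) ^ m) \<le> (?C * (\<sigma>\<^sup>2 * h)) ^ m"
      by (simp add: power_mult_distrib mult.assoc)
  qed (use gh C nonneg_f in auto)
  finally show ?thesis by (simp add: k_def)
qed

lemma (in prob_space) expectation_factor_mult:
  fixes P W :: "'a \<Rightarrow> complex ^ 'd ^ 'd"
  assumes ind: "indep_var borel P borel W"
    and bdP: "AE \<omega> in M. norm (P \<omega>) \<le> K" and bdW: "AE \<omega> in M. norm (W \<omega>) \<le> K'"
  shows "expectation (\<lambda>\<omega>. (mat 1 + W \<omega>) ** P \<omega>) = (mat 1 + expectation W) ** expectation P"
proof -
  have [measurable]: "P \<in> borel_measurable M" "W \<in> borel_measurable M"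
    using indep_var_rv1[OF ind] indep_var_rv2[OF ind] by auto
  let ?k = "\<lambda>z :: (complex ^ 'd ^ 'd) \<times> (complex ^ 'd ^ 'd). (mat 1 + snd z) ** fst z"
  have bdPW: "AE \<omega> in M. norm (P \<omega>, W \<omega>) \<le> K + K'"
    using bdP bdW
  proof eventually_elim
    case (elim \<omega>)
    then show ?case using norm_Pair_le[of "P \<omega>" "W \<omega>"] by simp
  qed
  have "(\<lambda>\<omega>. (P \<omega>, W \<omega>)) \<in> borel_measurable M"
    unfolding borel_prod[symmetric] by measurable
  from integrable_continuous_bounded[OF this bdPW continuous_on_factor_mult]
  have int_k: "integrable M (\<lambda>\<omega>. ?k (P \<omega>, W \<omega>))" .
  have intP: "integrable M P" and intW: "integrable M W"
    using integrable_continuous_bounded[OF _ bdP continuous_on_id]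
      integrable_continuous_bounded[OF _ bdW continuous_on_id] by simp_all
  have "expectation (\<lambda>\<omega>. ?k (P \<omega>, W \<omega>)) = expectation (\<lambda>\<omega>. expectation (\<lambda>\<omega>'. ?k (P \<omega>, W \<omega>')))"
    by (rule expectation_indep_var(1)[OF ind
          borel_measurable_pair_continuous[OF continuous_on_factor_mult] int_k])
  also have "\<dots> = expectation (\<lambda>\<omega>. (mat 1 + expectation W) ** P \<omega>)"
  proof -
    have "expectation (\<lambda>\<omega>'. (mat 1 + W \<omega>') ** p) = (mat 1 + expectation W) ** p"
      for p :: "complex ^ 'd ^ 'd"
      using integral_bounded_linear[OF matrix_mult.bounded_linear_left[of p],
          of M "\<lambda>\<omega>. mat 1 + W \<omega>"] intW by (simp add: prob_space)
    then show ?thesis by simp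
  qed
  also have "\<dots> = (mat 1 + expectation W) ** expectation P"
    by (rule integral_bounded_linear[OF matrix_mult.bounded_linear_right intP])
  finally show ?thesis by simp
qed

section \<open>Measurability, independence and boundedness of partial products\<close>

lemma perturbed_prod_cong:
  "(\<And>i. i \<in> {1..k} \<Longrightarrow> X i = Y i) \<Longrightarrow> perturbed_prod X k = perturbed_prod Y k"
  by (induction k) auto

lemma measurable_perturbed_prod:
  assumes "{1..k} \<subseteq> I"
  shows "(\<lambda>f :: nat \<Rightarrow> complex ^ 'd ^ 'd. perturbed_prod f k) \<in> borel_measurable (PiM I (\<lambda>_. borel))"
  using assms
proof (induction k)
  case (Suc k)
  have "{1..k} \<subseteq> I" using Suc.prems by (auto simp: subset_iff)
  then have 1: "(\<lambda>f :: nat \<Rightarrow> complex ^ 'd ^ 'd. perturbed_prod f k) \<in> borel_measurable (PiM I (\<lambda>_. borel))"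
    by (rule Suc.IH)
  have 2: "(\<lambda>f :: nat \<Rightarrow> complex ^ 'd ^ 'd. f (Suc k)) \<in> borel_measurable (PiM I (\<lambda>_. borel))"
    using Suc.prems by (intro measurable_component_singleton) auto
  have "(\<lambda>f :: nat \<Rightarrow> complex ^ 'd ^ 'd. (perturbed_prod f k, f (Suc k))) \<in> borel_measurable (PiM I (\<lambda>_. borel))"
    unfolding borel_prod[symmetric] using 1 2 by (intro measurable_Pair)
  from measurable_compose[OF this borel_measurable_continuous_onI[OF continuous_on_factor_mult]]
  show ?case by simp
qed simp

lemma (in prob_space) indep_var_perturbed_prod:
  fixes X :: "nat \<Rightarrow> 'a \<Rightarrow> complex ^ 'd ^ 'd"
  assumes ind: "indep_vars (\<lambda>_. borel) X {1..n}" and k: "Suc k \<le> n"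
  shows "indep_var borel (\<lambda>\<omega>. perturbed_prod (\<lambda>i. X i \<omega>) k) borel (X (Suc k))"
proof -
  have "indep_var
      borel ((\<lambda>f. perturbed_prod f k) \<circ> (\<lambda>\<omega>. restrict (\<lambda>i. X i \<omega>) {1..k}))
      borel ((\<lambda>f. f (Suc k)) \<circ> (\<lambda>\<omega>. restrict (\<lambda>i. X i \<omega>) {Suc k}))"
    by (rule indep_var_compose[OF indep_var_restrict[OF ind]])
       (use k in \<open>auto intro!: measurable_perturbed_prod measurable_component_singleton\<close>)
  also have "(\<lambda>f. perturbed_prod f k) \<circ> (\<lambda>\<omega>. restrict (\<lambda>i. X i \<omega>) {1..k}) =
      (\<lambda>\<omega>. perturbed_prod (\<lambda>i. X i \<omega>) k)"
    by (auto simp: fun_eq_iff intro!: perturbed_prod_cong)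
  also have "(\<lambda>f. f (Suc k)) \<circ> (\<lambda>\<omega>. restrict (\<lambda>i. X i \<omega>) {Suc k}) = X (Suc k)"
    by (auto simp: fun_eq_iff)
  finally show ?thesis .
qed

lemma (in prob_space) perturbed_prod_bounded:
  fixes X :: "nat \<Rightarrow> 'a \<Rightarrow> complex ^ 'd ^ 'd"
  assumes "\<And>i. i \<in> {1..n} \<Longrightarrow> \<exists>K. AE \<omega> in M. norm (X i \<omega>) \<le> K"
  shows "\<exists>K. AE \<omega> in M. norm (perturbed_prod (\<lambda>i. X i \<omega>) n) \<le> K"
  using assms
proof (induction n)
  case (Suc n)
  obtain K where K: "AE \<omega> in M. norm (perturbed_prod (\<lambda>i. X i \<omega>) n) \<le> K"
    using Suc.IH Suc.prems by (meson atLeastAtMost_iff le_SucI)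
  obtain L where L: "AE \<omega> in M. norm (X (Suc n) \<omega>) \<le> L"
    using Suc.prems[of "Suc n"] by auto
  have "AE \<omega> in M. norm (perturbed_prod (\<lambda>i. X i \<omega>) (Suc n)) \<le>
      (norm (mat 1 :: complex ^ 'd ^ 'd) + L) * K"
    using K L
  proof eventually_elim
    case (elim \<omega>)
    have "norm (mat 1 + X (Suc n) \<omega>) \<le> norm (mat 1 :: complex ^ 'd ^ 'd) + L"
      using norm_triangle_ineq[of "mat 1" "X (Suc n) \<omega>"] elim by linarith
    moreover have "L \<ge> 0" using elim norm_ge_zero order.trans by blast
    ultimately show ?case
      unfolding perturbed_prod.simps using elim
      by (intro order.trans[OF norm_matrix_mult_le] mult_mono) auto
  qed
  then show ?case by blast
qed auto

lemma square_one_plus_le_exp: "(1 + \<xi>)\<^sup>2 \<le> exp (2 * \<xi>)" if "\<xi> \<ge> 0" for \<xi> :: real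
  using power_mono[OF exp_ge_add_one_self[of \<xi>], of 2] that
  by (simp add: exp_double[symmetric] mult.commute)

text \<open>With \<open>u = (2 m - 1) \<sigma>\<^sup>2\<close> the squared norms obey
  \<open>g' = (1 + \<xi>)\<^sup>2 g + u g\<close> and
  \<open>h' = (1 + \<xi>)\<^sup>2 h + u g\<close>, started at 1 and 0 up to the common factor
  \<open>?r\<close>. \<open>G\<close> and \<open>H\<close> are closed forms that dominate these
  recursions.\<close>

lemma (in prob_space) schatten_perturbed_prod:
  fixes X :: "nat \<Rightarrow> 'a \<Rightarrow> complex ^ 'd ^ 'd"
  assumes m: "m > 0" and ind: "indep_vars (\<lambda>_. borel) X {1..n}"
    and mean: "\<And>i. i \<in> {1..n} \<Longrightarrow> spectral_norm (expectation (X i)) \<le> \<xi> i"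
    and dev: "\<And>i. i \<in> {1..n} \<Longrightarrow> AE \<omega> in M. spectral_norm (X i \<omega> - expectation (X i)) \<le> \<sigma> i"
  defines "Z \<equiv> (\<lambda>k \<omega>. perturbed_prod (\<lambda>i. X i \<omega>) k)"
    and "s \<equiv> (\<lambda>k. \<Sum>i=1..k. \<xi> i)" and "v \<equiv> (\<lambda>k. \<Sum>i=1..k. (\<sigma> i)\<^sup>2)"
  shows "expectation (\<lambda>\<omega>. schatten_pow m (Z n \<omega>))
      \<le> real CARD('d) * exp (2 * s n + (2 * real m - 1) * v n) ^ m" (is ?growth)
    and "expectation (\<lambda>\<omega>. schatten_pow m (Z n \<omega> - expectation (Z n)))
      \<le> real CARD('d) * (exp (2 * s n) * (exp ((2 * real m - 1) * v n) - 1)) ^ m" (is ?fluctuation)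
proof -
  let ?C = "2 * real m - 1" and ?r = "root m (real CARD('d))"
  have C: "?C \<ge> 0" using m by simp
  define G where "G k = exp (2 * s k + ?C * v k)" for k
  define H where "H k = exp (2 * s k) * (exp (?C * v k) - 1)" for k
  have G_eq: "G k = exp (2 * s k) * exp (?C * v k)" for k by (simp add: G_def exp_add)
  have v_nonneg: "v k \<ge> 0" for k unfolding v_def by (intro sum_nonneg) auto
  have GH: "G k \<ge> 0" "H k \<ge> 0" for k
    using C v_nonneg[of k] by (auto simp: G_def H_def)
  have r: "?r \<ge> 0" "?r ^ m = real CARD('d)" using m by simp_all
  have "expectation (\<lambda>\<omega>. schatten_pow m (Z k \<omega>)) \<le> (?r * G k) ^ m \<and>
    expectation (\<lambda>\<omega>. schatten_pow m (Z k \<omega> - expectation (Z k))) \<le> (?r * H k) ^ m"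
    if "k \<le> n" for k
    using that
  proof (induction k)
    case 0
    have "G 0 = 1" "H 0 = 0" by (simp_all add: G_def H_def s_def v_def)
    then show ?case
      using m r by (simp add: Z_def prob_space schatten_pow_mat_1 schatten_pow_0)
  next
    case (Suc k)
    then have k: "Suc k \<in> {1..n}" by simp
    let ?W = "X (Suc k)"
    have \<xi>: "\<xi> (Suc k) \<ge> 0"
      using mean[OF k] spectral_norm_nonneg[of "expectation ?W"] by linarith
    have ind': "indep_var borel (Z k) borel ?W"
      unfolding Z_def by (rule indep_var_perturbed_prod[OF ind Suc.prems])
    have bd: "\<exists>K. AE \<omega> in M. norm (X i \<omega>) \<le> K" if "i \<in> {1..n}" for i
      using AE_norm_le_of_spectral[OF dev[OF that]] by blast
    have "\<exists>K. AE \<omega> in M. norm (Z k \<omega>) \<le> K"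
      unfolding Z_def using Suc.prems by (intro perturbed_prod_bounded bd) auto
    then obtain K where K: "AE \<omega> in M. norm (Z k \<omega>) \<le> K" ..
    note bdW = AE_norm_le_of_spectral[OF dev[OF k]]
    have Z_Suc: "Z (Suc k) = (\<lambda>\<omega>. (mat 1 + ?W \<omega>) ** Z k \<omega>)"
      by (simp add: Z_def fun_eq_iff)
    have EZ: "expectation (Z (Suc k)) = (mat 1 + expectation ?W) ** expectation (Z k)"
      unfolding Z_Suc by (rule expectation_factor_mult[OF ind' K bdW])
    note IH = Suc.IH[OF Suc_leD[OF Suc.prems]]
    have sv: "s (Suc k) = s k + \<xi> (Suc k)" "v (Suc k) = v k + (\<sigma> (Suc k))\<^sup>2"
      by (simp_all add: s_def v_def)
    let ?u = "?C * (\<sigma> (Suc k))\<^sup>2" and ?e = "exp (2 * \<xi> (Suc k))"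
    have u: "?u \<ge> 0" and e: "(1 + \<xi> (Suc k))\<^sup>2 \<le> ?e" "1 \<le> ?e"
      using C \<xi> square_one_plus_le_exp by simp_all
    have G_step: "(1 + \<xi> (Suc k))\<^sup>2 * G k + ?u * G k \<le> G (Suc k)"
    proof -
      \<comment> \<open>The noise term is enlarged by \<open>?e \<ge> 1\<close> so that
        \<open>?e\<close> comes out of the whole sum and \<open>1 + ?u \<le> exp ?u\<close> handles
        the rest.\<close>
      have "(1 + \<xi> (Suc k))\<^sup>2 * G k + ?u * G k \<le> ?e * G k + ?e * (?u * G k)"
        using e u GH(1)[of k] mult_right_mono[of 1 ?e "?u * G k"]
        by (intro add_mono mult_right_mono) auto
      also have "\<dots> = ?e * G k * (1 + ?u)" by (simp add: algebra_simps)
      also have "\<dots> \<le> ?e * G k * exp ?u"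
        using GH(1)[of k] exp_ge_add_one_self by (intro mult_left_mono) auto
      also have "\<dots> = G (Suc k)"
        by (simp add: G_def sv algebra_simps flip: exp_add)
      finally show ?thesis .
    qed
    have H_step: "(1 + \<xi> (Suc k))\<^sup>2 * H k + ?u * G k \<le> H (Suc k)"
    proof -
      have "(1 + \<xi> (Suc k))\<^sup>2 * H k + ?u * G k \<le> ?e * H k + ?e * (?u * G k)"
        using e u GH[of k] mult_right_mono[of 1 ?e "?u * G k"]
        by (intro add_mono mult_right_mono) auto
      \<comment> \<open>The factorisation rests on \<open>G k - H k = exp (2 * s k)\<close>.\<close>
      also have "\<dots> = ?e * exp (2 * s k) * (exp (?C * v k) * (1 + ?u) - 1)"
        unfolding G_eq H_def by (simp add: algebra_simps)
      also have "\<dots> \<le> ?e * exp (2 * s k) * (exp (?C * v k) * exp ?u - 1)"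
        using exp_ge_add_one_self[of ?u] by (intro mult_left_mono diff_right_mono) auto
      also have "\<dots> = H (Suc k)"
        by (simp add: H_def sv algebra_simps flip: exp_add)
      finally show ?thesis .
    qed
    note step = schatten_product_step[OF m ind' K mean[OF k] dev[OF k]]
    have "expectation (\<lambda>\<omega>. schatten_pow m (Z (Suc k) \<omega>))
        \<le> ((1 + \<xi> (Suc k))\<^sup>2 * (?r * G k) + ?C * ((\<sigma> (Suc k))\<^sup>2 * (?r * G k))) ^ m"
      using step[of "?r * G k" "?r * G k" 0] IH r GH[of k] by (simp add: Z_Suc)
    also have "\<dots> = (?r * ((1 + \<xi> (Suc k))\<^sup>2 * G k + ?u * G k)) ^ m"
      by (simp add: algebra_simps)
    also have "\<dots> \<le> (?r * G (Suc k)) ^ m"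
      using G_step r u GH[of k] by (intro power_mono mult_left_mono) auto
    finally have growth: "expectation (\<lambda>\<omega>. schatten_pow m (Z (Suc k) \<omega>)) \<le> (?r * G (Suc k)) ^ m" .
    have "expectation (\<lambda>\<omega>. schatten_pow m (Z (Suc k) \<omega> - expectation (Z (Suc k))))
        \<le> ((1 + \<xi> (Suc k))\<^sup>2 * (?r * H k) + ?C * ((\<sigma> (Suc k))\<^sup>2 * (?r * G k))) ^ m"
      unfolding EZ unfolding Z_Suc using IH r GH[of k] by (intro step) auto
    also have "\<dots> = (?r * ((1 + \<xi> (Suc k))\<^sup>2 * H k + ?u * G k)) ^ m"
      by (simp add: algebra_simps)
    also have "\<dots> \<le> (?r * H (Suc k)) ^ m"
      using H_step r u GH[of k] by (intro power_mono mult_left_mono) auto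
    finally show ?case using growth by simp
  qed
  from this[of n] show ?growth ?fluctuation
    by (simp_all add: G_def H_def power_mult_distrib r(2))
qed

section \<open>From Schatten moments to the mean and the tail of the spectral norm\<close>

lemma (in prob_space) expectation_spectral_norm_le:
  fixes R :: "'a \<Rightarrow> complex ^ 'd ^ 'd"
  assumes m: "m > 0" and R: "R \<in> borel_measurable M" and bd: "AE \<omega> in M. norm (R \<omega>) \<le> K"
    and c: "c > 0" and a: "a \<ge> 0" and le: "expectation (\<lambda>\<omega>. schatten_pow m (R \<omega>)) \<le> c * a ^ m"
  shows "expectation (\<lambda>\<omega>. spectral_norm (R \<omega>)) \<le> c powr (1 / (2 * real m)) * sqrt a"
proof -
  note integrableR = integrable_continuous_bounded[OF R bd]
  define u where "u = expectation (\<lambda>\<omega>. spectral_norm (R \<omega>))"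
  have u: "u \<ge> 0" by (simp add: u_def)
  obtain k where k: "2 * m = Suc k" using m by (cases "2 * m") auto
  have int: "integrable M (\<lambda>\<omega>. spectral_norm (R \<omega>))"
    "integrable M (\<lambda>\<omega>. spectral_norm (R \<omega>) ^ Suc k)"
    "integrable M (\<lambda>\<omega>. schatten_pow m (R \<omega>))"
    by (intro integrableR[of spectral_norm] integrableR[of "\<lambda>x. spectral_norm x ^ Suc k"]
        integrableR[of "schatten_pow m"] continuous_on_power continuous_on_spectral_norm
        continuous_on_schatten_pow)+
  \<comment> \<open>Jensen for the power \<open>2 * m\<close>: the tangent inequality at the mean
    \<open>u\<close> is integrated.\<close>
  have "real (Suc k) * (u ^ k * u) = expectation (\<lambda>\<omega>. real (Suc k) * (u ^ k * spectral_norm (R \<omega>)))"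
    by (simp add: u_def)
  also have "\<dots> \<le> expectation (\<lambda>\<omega>. real k * u ^ Suc k + spectral_norm (R \<omega>) ^ Suc k)"
    by (rule integral_mono) (use int u power_tangent_le in auto)
  also have "\<dots> = real k * u ^ Suc k + expectation (\<lambda>\<omega>. spectral_norm (R \<omega>) ^ Suc k)"
    using int by (simp add: prob_space del: power_Suc)
  finally have "u ^ Suc k \<le> expectation (\<lambda>\<omega>. spectral_norm (R \<omega>) ^ Suc k)"
    by (simp add: algebra_simps)
  also have "\<dots> \<le> expectation (\<lambda>\<omega>. schatten_pow m (R \<omega>))"
    using spectral_norm_power_le_schatten_pow[OF m] int(2,3)
    by (intro integral_mono) (simp_all only: k)
  also note le
  also have "c * a ^ m = (c powr (1 / (2 * real m)) * sqrt a) ^ (2 * m)"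
  proof -
    have "(c powr (1 / (2 * real m))) ^ (2 * m) = c"
      using c m by (subst powr_realpow[symmetric]) (simp_all add: powr_powr)
    then show ?thesis using a by (simp add: power_mult_distrib power_mult[of "sqrt a"])
  qed
  finally have "u ^ (2 * m) \<le> (c powr (1 / (2 * real m)) * sqrt a) ^ (2 * m)" by (simp only: k)
  then show ?thesis
    using m u a by (subst (asm) power_mono_iff) (simp_all add: u_def)
qed

lemma (in prob_space) prob_spectral_norm_le:
  fixes R :: "'a \<Rightarrow> complex ^ 'd ^ 'd"
  assumes m: "m > 0" and R[measurable]: "R \<in> borel_measurable M" and bd: "AE \<omega> in M. norm (R \<omega>) \<le> K"
    and \<tau>: "\<tau> > 0" and le: "expectation (\<lambda>\<omega>. schatten_pow m (R \<omega>)) \<le> c * a ^ m"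
  shows "\<P>(\<omega> in M. spectral_norm (R \<omega>) \<ge> \<tau>) \<le> c * (a / \<tau>\<^sup>2) ^ m"
proof -
  have int: "integrable M (\<lambda>\<omega>. schatten_pow m (R \<omega>))"
    by (rule integrable_continuous_bounded[OF R bd continuous_on_schatten_pow])
  have [measurable]: "(\<lambda>\<omega>. schatten_pow m (R \<omega>)) \<in> borel_measurable M"
    using int by (rule borel_measurable_integrable)
  have "\<P>(\<omega> in M. spectral_norm (R \<omega>) \<ge> \<tau>) \<le> \<P>(\<omega> in M. schatten_pow m (R \<omega>) \<ge> \<tau> ^ (2 * m))"
  proof (rule finite_measure_mono)
    show "{\<omega> \<in> space M. \<tau> \<le> spectral_norm (R \<omega>)} \<subseteq> {\<omega> \<in> space M. \<tau> ^ (2 * m) \<le> schatten_pow m (R \<omega>)}"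
      using spectral_norm_power_le_schatten_pow[OF m] power_mono[of \<tau> _ "2 * m"] \<tau>
      by (auto intro: order.trans)
  qed measurable
  also have "\<dots> \<le> expectation (\<lambda>\<omega>. schatten_pow m (R \<omega>)) / \<tau> ^ (2 * m)"
    using int \<tau> by (intro integral_Markov_inequality_measure[where A = "{}"]) auto
  also have "\<dots> \<le> c * a ^ m / \<tau> ^ (2 * m)"
    using le \<tau> by (intro divide_right_mono) auto
  also have "\<dots> = c * (a / \<tau>\<^sup>2) ^ m"
    by (simp add: power_divide power_mult)
  finally show ?thesis .
qed

subsection \<open>Choice of the Schatten exponent\<close>

text \<open>A half-open interval of length 2 contains exactly one even integer, and
  \<open>p\<^sub>0 \<ge> 1\<close> makes it positive.\<close>

lemma even_near:
  fixes p\<^sub>0 :: real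
  assumes "p\<^sub>0 \<ge> 1"
  obtains m :: nat where "m > 0" "2 * real m > p\<^sub>0 - 1" "2 * real m \<le> p\<^sub>0 + 1"
proof
  let ?m = "nat \<lfloor>(p\<^sub>0 + 1) / 2\<rfloor>"
  have 1: "\<lfloor>(p\<^sub>0 + 1) / 2\<rfloor> \<ge> 1" using assms by (simp add: le_floor_iff)
  then have eq: "real ?m = real_of_int \<lfloor>(p\<^sub>0 + 1) / 2\<rfloor>" by simp
  show "?m > 0" using 1 by simp
  show "2 * real ?m > p\<^sub>0 - 1"
    unfolding eq using real_of_int_floor_gt_diff_one[of "(p\<^sub>0 + 1) / 2"] by argo
  show "2 * real ?m \<le> p\<^sub>0 + 1"
    unfolding eq using of_int_floor_le[of "(p\<^sub>0 + 1) / 2"] by argo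
qed

text \<open>The slack between the factors \<open>p\<close> and \<open>p - 1\<close> pays for rounding the optimal exponent to an
  even integer.\<close>

lemma near_square_le:
  fixes p p\<^sub>0 :: real
  assumes "p > p\<^sub>0 - 1" "p \<le> p\<^sub>0 + 1" "p \<ge> 1"
  shows "p\<^sub>0\<^sup>2 + p * (p - 1) \<le> 2 * p * p\<^sub>0"
proof -
  have "\<bar>p - p\<^sub>0\<bar> \<le> 1" using assms by linarith
  then have "(p - p\<^sub>0)\<^sup>2 \<le> 1" by (simp add: abs_square_le_1)
  then show ?thesis using assms(3) by (simp add: power2_eq_square algebra_simps)
qed

lemma exp_minus_one_le:
  fixes u :: real
  assumes "0 \<le> u" "u \<le> 1"
  shows "exp u - 1 \<le> exp 1 * u"
proof -
  have "(1 - u) * exp u \<le> exp (- u) * exp u"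
    using exp_ge_add_one_self[of "- u"] by (intro mult_right_mono) auto
  then have "exp u - 1 \<le> exp u * u" by (simp add: algebra_simps flip: exp_add)
  also have "\<dots> \<le> exp 1 * u" using assms by (intro mult_right_mono) auto
  finally show ?thesis .
qed

lemma growth_exponent:
  fixes d v s :: real
  assumes d: "d \<ge> 1" and v: "v > 0" "2 * v \<le> ln d"
  obtains m :: nat where "m > 0"
    "d powr (1 / (2 * real m)) * sqrt (exp (2 * s + (2 * real m - 1) * v))
      \<le> exp (s + sqrt (2 * v * ln d))"
proof -
  define L where "L = ln d"
  \<comment> \<open>The minimiser of \<open>L / p + p * v / 2\<close> over real \<open>p\<close>,
    with minimum \<open>v * p\<^sub>0 = sqrt (2 * v * L)\<close>. The hypothesis
    \<open>2 * v \<le> ln d\<close> says that it is at least 2.\<close>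
  define p\<^sub>0 where "p\<^sub>0 = sqrt (2 * L / v)"
  have L: "L \<ge> 0" using d by (simp add: L_def)
  have p0_sq: "p\<^sub>0\<^sup>2 = 2 * L / v" using L v by (simp add: p\<^sub>0_def)
  have "2\<^sup>2 \<le> p\<^sub>0\<^sup>2" unfolding p0_sq using v by (simp add: L_def divide_simps)
  then have p0: "p\<^sub>0 \<ge> 2" using L v by (simp add: p\<^sub>0_def real_le_rsqrt)
  then have "p\<^sub>0 \<ge> 1" by simp
  from even_near[OF this] obtain m :: nat
    where m: "m > 0" "2 * real m > p\<^sub>0 - 1" "2 * real m \<le> p\<^sub>0 + 1" .
  define p where "p = 2 * real m"
  have p: "p > 0" "p \<ge> 1" using m by (simp_all add: p_def)
  have Lv: "L = v * p\<^sub>0\<^sup>2 / 2" unfolding p0_sq using v by simp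
  have "sqrt (2 * v * L) = sqrt ((v * p\<^sub>0)\<^sup>2)"
    unfolding Lv by (simp add: power2_eq_square mult_ac)
  also have "\<dots> = v * p\<^sub>0" using v p0 by simp
  finally have root: "sqrt (2 * v * ln d) = v * p\<^sub>0" by (simp add: L_def)
  have "v * (p\<^sub>0\<^sup>2 + p * (p - 1)) \<le> v * (2 * p * p\<^sub>0)"
    using near_square_le[of p\<^sub>0 p] m p v by (intro mult_left_mono) (auto simp: p_def)
  then have exponent: "L / p + (p - 1) * v / 2 \<le> v * p\<^sub>0"
    unfolding Lv using p by (simp add: field_simps)
  have "d powr (1 / p) * sqrt (exp (2 * s + (p - 1) * v)) = exp (L / p) * exp (s + (p - 1) * v / 2)"
  proof -
    have "2 * s + (p - 1) * v = 2 * (s + (p - 1) * v / 2)" by simp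
    then have "sqrt (exp (2 * s + (p - 1) * v)) = sqrt ((exp (s + (p - 1) * v / 2))\<^sup>2)"
      by (simp only: exp_double)
    then show ?thesis using d by (simp add: powr_def L_def)
  qed
  also have "\<dots> = exp (s + (L / p + (p - 1) * v / 2))"
    unfolding exp_add[symmetric] by (simp add: add_ac)
  also have "\<dots> \<le> exp (s + sqrt (2 * v * ln d))" unfolding root using exponent by simp
  finally show ?thesis using that[OF m(1)] by (simp add: p_def)
qed

lemma fluctuation_exponent:
  fixes d v s :: real
  assumes d: "d \<ge> 1" and v: "v \<ge> 0" "v * (1 + 2 * ln d) \<le> 1"
  obtains m :: nat where "m > 0"
    "d powr (1 / (2 * real m)) * sqrt (exp (2 * s) * (exp ((2 * real m - 1) * v) - 1))
      \<le> exp (s + 1) * sqrt (v * (1 + 2 * ln d))"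
proof -
  define L where "L = ln d"
  have L: "L \<ge> 0" using d by (simp add: L_def)
  \<comment> \<open>Both ends of the window around \<open>2 * L + 1\<close> matter:
    \<open>p > 2 * L\<close> keeps \<open>d powr (1 / p)\<close> below \<open>exp (1 / 2)\<close>,
    and \<open>p - 1 \<le> 2 * L + 1\<close> keeps \<open>u\<close> below 1. The second half of the
    exponent 1 in \<open>exp (s + 1)\<close> is the square root of the \<open>e\<close> in
    \<open>exp_minus_one_le\<close>.\<close>
  have "2 * L + 1 \<ge> 1" using L by simp
  from even_near[OF this] obtain m :: nat
    where "m > 0" "2 * real m > 2 * L + 1 - 1" "2 * real m \<le> 2 * L + 1 + 1" .
  then have m: "m > 0" "2 * real m > 2 * L" "2 * real m \<le> 2 * L + 2" by simp_all
  define u where "u = (2 * real m - 1) * v"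
  have "u \<le> (1 + 2 * L) * v" unfolding u_def using m v by (intro mult_right_mono) auto
  then have u: "0 \<le> u" "u \<le> v * (1 + 2 * L)"
    using m v by (simp_all add: u_def mult.commute)
  have "exp u - 1 \<le> exp 1 * u" using u v by (intro exp_minus_one_le) (auto simp: L_def)
  also have "\<dots> \<le> exp 1 * (v * (1 + 2 * L))" using u by (intro mult_left_mono) auto
  finally have "exp (2 * s) * (exp u - 1) \<le> exp (2 * s) * (exp 1 * (v * (1 + 2 * L)))"
    by (intro mult_left_mono) auto
  also have "\<dots> = (exp (s + 1 / 2))\<^sup>2 * (v * (1 + 2 * L))"
  proof -
    have "(exp (s + 1 / 2))\<^sup>2 = exp (2 * s + 1)" by (simp add: distrib_left flip: exp_double)
    also have "\<dots> = exp (2 * s) * exp 1" by (rule exp_add)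
    finally show ?thesis by (simp only: mult.assoc)
  qed
  finally have "sqrt (exp (2 * s) * (exp u - 1)) \<le> sqrt ((exp (s + 1 / 2))\<^sup>2 * (v * (1 + 2 * L)))"
    by (rule real_sqrt_le_mono)
  also have "\<dots> = exp (s + 1 / 2) * sqrt (v * (1 + 2 * L))" by (simp add: real_sqrt_mult)
  finally have root: "sqrt (exp (2 * s) * (exp u - 1)) \<le> exp (s + 1 / 2) * sqrt (v * (1 + 2 * L))" .
  have "d powr (1 / (2 * real m)) = exp (L / (2 * real m))" using d by (simp add: powr_def L_def)
  also have "\<dots> \<le> exp (1 / 2)" using m L by (simp add: divide_le_eq)
  finally have "d powr (1 / (2 * real m)) * sqrt (exp (2 * s) * (exp u - 1))
      \<le> exp (1 / 2) * (exp (s + 1 / 2) * sqrt (v * (1 + 2 * L)))"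
    using root u by (intro mult_mono) auto
  also have "\<dots> = exp (1 / 2 + (s + 1 / 2)) * sqrt (v * (1 + 2 * L))"
    by (simp only: exp_add mult.assoc)
  also have "1 / 2 + (s + 1 / 2) = s + 1" by simp
  finally show ?thesis using that[OF m(1)] by (simp add: u_def L_def)
qed

lemma growth_tail_exponent:
  fixes v s t :: real
  assumes v: "v > 0" and t: "t > 0" "ln t \<ge> 2 * v"
  obtains m :: nat where "m > 0"
    "(exp (2 * s + (2 * real m - 1) * v) / (t * exp s)\<^sup>2) ^ m \<le> exp (- (ln t)\<^sup>2 / (2 * v))"
proof -
  \<comment> \<open>With \<open>p\<close> in place of \<open>p - 1\<close> the exponent is
    \<open>p\<^sup>2 * v / 2 - p * ln t\<close>, which is minimal here with the value
    \<open>- (ln t)\<^sup>2 / (2 * v)\<close>.\<close>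
  define p\<^sub>0 where "p\<^sub>0 = ln t / v"
  have p0: "p\<^sub>0 \<ge> 2" using t v by (simp add: p\<^sub>0_def le_divide_eq)
  then have "p\<^sub>0 \<ge> 1" by simp
  from even_near[OF this] obtain m :: nat
    where m: "m > 0" "2 * real m > p\<^sub>0 - 1" "2 * real m \<le> p\<^sub>0 + 1" .
  define p where "p = 2 * real m"
  have lnt: "ln t = v * p\<^sub>0" using v by (simp add: p\<^sub>0_def)
  then have "t = exp (v * p\<^sub>0)" using t by (metis exp_ln)
  then have "exp (2 * s + (p - 1) * v) / (t * exp s)\<^sup>2 = exp ((p - 1) * v - 2 * (v * p\<^sub>0))"
    by (simp add: power_mult_distrib exp_add exp_diff flip: exp_double)
  then have "(exp (2 * s + (p - 1) * v) / (t * exp s)\<^sup>2) ^ m =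
      exp (real m * ((p - 1) * v - 2 * (v * p\<^sub>0)))"
    by (simp add: exp_of_nat_mult)
  also have "\<dots> \<le> exp (- (ln t)\<^sup>2 / (2 * v))"
  proof -
    have "v * (p\<^sub>0\<^sup>2 + p * (p - 1)) \<le> v * (2 * p * p\<^sub>0)"
      using near_square_le[of p\<^sub>0 p] m v by (intro mult_left_mono) (auto simp: p_def)
    then have "p * ((p - 1) * v - 2 * (v * p\<^sub>0)) \<le> - (v * p\<^sub>0\<^sup>2)" by (simp add: algebra_simps)
    moreover have "(ln t)\<^sup>2 / (2 * v) = v * p\<^sub>0\<^sup>2 / 2"
      unfolding lnt using v by (simp add: power2_eq_square)
    ultimately show ?thesis by (simp add: p_def)
  qed
  finally show ?thesis using that[OF m(1)] by (simp add: p_def)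
qed

lemma fluctuation_tail_exponent:
  fixes v s t :: real
  assumes v: "v > 0" and t: "t > 0" "t \<le> exp 1" "t\<^sup>2 \<ge> 2 * (exp 1)\<^sup>2 * v"
  obtains m :: nat where "m > 0"
    "(exp (2 * s) * (exp ((2 * real m - 1) * v) - 1) / (t * exp s)\<^sup>2) ^ m
      \<le> exp (- t\<^sup>2 / (2 * (exp 1)\<^sup>2 * v))"
proof -
  \<comment> \<open>With \<open>p\<close> in place of \<open>p - 1\<close> and
    \<open>exp u - 1\<close> replaced by \<open>e * u\<close>, the bound is
    \<open>p / (e * p\<^sub>0)\<close> to the power \<open>p / 2\<close>. It is minimal at
    \<open>p = p\<^sub>0\<close>, with the value \<open>exp (- p\<^sub>0 / 2)\<close>.\<close>
  define p\<^sub>0 where "p\<^sub>0 = t\<^sup>2 / ((exp 1)\<^sup>2 * v)"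
  have p0: "p\<^sub>0 \<ge> 2" using t v by (simp add: p\<^sub>0_def le_divide_eq)
  then have "p\<^sub>0 \<ge> 1" by simp
  from even_near[OF this] obtain m :: nat
    where m: "m > 0" "2 * real m > p\<^sub>0 - 1" "2 * real m \<le> p\<^sub>0 + 1" .
  define p where "p = 2 * real m"
  have p: "p \<ge> 1" "p \<le> p\<^sub>0 + 1" using m by (simp_all add: p_def)
  have tt: "t\<^sup>2 = exp 1 * exp 1 * v * p\<^sub>0" using v by (simp add: p\<^sub>0_def power2_eq_square)
  \<comment> \<open>The condition \<open>t \<le> exp 1\<close> amounts to
    \<open>v * p\<^sub>0 \<le> 1\<close> and keeps \<open>(p - 1) * v\<close> in the range where
    \<open>exp u - 1\<close> has a linear bound.\<close>
  have "t\<^sup>2 \<le> (exp 1)\<^sup>2" using t by (intro power_mono) auto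
  then have "v * p\<^sub>0 \<le> 1" unfolding tt by (simp add: power2_eq_square)
  moreover have "(p - 1) * v \<le> p\<^sub>0 * v" using p v by (intro mult_right_mono) auto
  ultimately have "(p - 1) * v \<le> 1" using mult.commute[of v p\<^sub>0] by linarith
  then have "exp ((p - 1) * v) - 1 \<le> exp 1 * ((p - 1) * v)"
    using p v by (intro exp_minus_one_le) auto
  then have "(exp ((p - 1) * v) - 1) / t\<^sup>2 \<le> exp 1 * ((p - 1) * v) / t\<^sup>2"
    by (intro divide_right_mono) auto
  also have "\<dots> = exp (- 1) * ((p - 1) / p\<^sub>0)"
    unfolding tt using v p0 by (simp add: exp_minus field_simps)
  \<comment> \<open>The rounding inequality divided by \<open>p * p\<^sub>0\<close>.\<close>
  also have "(p - 1) / p\<^sub>0 \<le> 2 - p\<^sub>0 / p"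
  proof -
    have "p\<^sub>0\<^sup>2 + p * (p - 1) \<le> 2 * p * p\<^sub>0" using near_square_le[of p\<^sub>0 p] m by (auto simp: p_def)
    then show ?thesis using p p0 by (simp add: field_simps power2_eq_square)
  qed
  also have "2 - p\<^sub>0 / p \<le> exp (1 - p\<^sub>0 / p)"
    using exp_ge_add_one_self[of "1 - p\<^sub>0 / p"] by simp
  also have "exp (- 1) * exp (1 - p\<^sub>0 / p) = exp (- p\<^sub>0 / p)"
    by (simp flip: exp_add)
  finally have base: "(exp ((p - 1) * v) - 1) / t\<^sup>2 \<le> exp (- p\<^sub>0 / p)" by simp
  have "exp (2 * s) * (exp ((p - 1) * v) - 1) / (t * exp s)\<^sup>2 = (exp ((p - 1) * v) - 1) / t\<^sup>2"
    by (simp add: power_mult_distrib flip: exp_double)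
  then have "(exp (2 * s) * (exp ((p - 1) * v) - 1) / (t * exp s)\<^sup>2) ^ m \<le> exp (- p\<^sub>0 / p) ^ m"
    using base p v by (simp only:) (intro power_mono, auto)
  also have "\<dots> = exp (- p\<^sub>0 / 2)" using m by (simp add: p_def flip: exp_of_nat_mult)
  also have "- p\<^sub>0 / 2 = - t\<^sup>2 / (2 * (exp 1)\<^sup>2 * v)" by (simp add: p\<^sub>0_def)
  finally show ?thesis using that[OF m(1)] by (simp add: p_def)
qed

section \<open>Assembly of the four bounds\<close>

theorem corollary6p1:
  fixes M :: "'a measure"
    and n :: nat
    and X :: "nat \<Rightarrow> 'a \<Rightarrow> complex ^ 'd ^ 'd"
    and Z :: "'a \<Rightarrow> complex ^ 'd ^ 'd"
    and \<xi> \<sigma> :: "nat \<Rightarrow> real"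
    and \<xi>\<^sub>t\<^sub>o\<^sub>t v d :: real
  assumes "prob_space M"
    and "prob_space.indep_vars M (\<lambda>_. borel) X {1..n}"
    and "\<And>i. i \<in> {1..n} \<Longrightarrow> spectral_norm (\<integral>\<omega>. X i \<omega> \<partial>M) \<le> \<xi> i"
    and "\<And>i. i \<in> {1..n} \<Longrightarrow>
           AE \<omega> in M. spectral_norm (X i \<omega> - (\<integral>\<omega>'. X i \<omega>' \<partial>M)) \<le> \<sigma> i"
    and "Z = (\<lambda>\<omega>. perturbed_prod (\<lambda>i. X i \<omega>) n)"
    and "\<xi>\<^sub>t\<^sub>o\<^sub>t = (\<Sum>i=1..n. \<xi> i)"
    and "v = (\<Sum>i=1..n. (\<sigma> i)\<^sup>2)"
    and "d = real CARD('d)"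
  shows "(2 * v \<le> ln d \<longrightarrow>
            (\<integral>\<omega>. spectral_norm (Z \<omega>) \<partial>M) \<le> exp (\<xi>\<^sub>t\<^sub>o\<^sub>t + sqrt (2 * v * ln d))) \<and>
         (v * (1 + 2 * ln d) \<le> 1 \<longrightarrow>
            (\<integral>\<omega>. spectral_norm (Z \<omega> - (\<integral>\<omega>'. Z \<omega>' \<partial>M)) \<partial>M)
              \<le> exp (\<xi>\<^sub>t\<^sub>o\<^sub>t + 1) * sqrt (v * (1 + 2 * ln d))) \<and>
         (v > 0 \<longrightarrow>
            (\<forall>t. t > 0 \<and> ln t \<ge> 2 * v \<longrightarrow>
               \<P>(\<omega> in M. spectral_norm (Z \<omega>) \<ge> t * exp \<xi>\<^sub>t\<^sub>o\<^sub>t)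
                 \<le> d * exp (- (ln t)\<^sup>2 / (2 * v))) \<and>
            (\<forall>t. 0 \<le> t \<and> t \<le> exp 1 \<longrightarrow>
               \<P>(\<omega> in M. spectral_norm (Z \<omega> - (\<integral>\<omega>'. Z \<omega>' \<partial>M)) \<ge> t * exp \<xi>\<^sub>t\<^sub>o\<^sub>t)
                 \<le> max d (exp 1) * exp (- t\<^sup>2 / (2 * (exp 1)\<^sup>2 * v))))"
proof -
  interpret prob_space M by fact
  let ?s = "\<xi>\<^sub>t\<^sub>o\<^sub>t" and ?Z' = "\<lambda>\<omega>. Z \<omega> - expectation Z"
  note moments = schatten_perturbed_prod[OF _ assms(2-4)]
  have growth: "expectation (\<lambda>\<omega>. schatten_pow m (Z \<omega>)) \<le> d * exp (2 * ?s + (2 * real m - 1) * v) ^ m"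
    and fluct: "expectation (\<lambda>\<omega>. schatten_pow m (?Z' \<omega>))
      \<le> d * (exp (2 * ?s) * (exp ((2 * real m - 1) * v) - 1)) ^ m" if "m > 0" for m
    using moments[OF that] unfolding assms(5-8) by simp_all
  have X_meas: "X i \<in> borel_measurable M" if "i \<in> {1..n}" for i
    using assms(2) that unfolding indep_vars_def by auto
  have "(\<lambda>\<omega>. restrict (\<lambda>i. X i \<omega>) {1..n}) \<in> measurable M (PiM {1..n} (\<lambda>_. borel))"
    using X_meas by (intro measurable_restrict)
  from measurable_compose[OF this measurable_perturbed_prod[OF order_refl]]
  have "(\<lambda>\<omega>. perturbed_prod (restrict (\<lambda>i. X i \<omega>) {1..n}) n) \<in> borel_measurable M" .
  also have "(\<lambda>\<omega>. perturbed_prod (restrict (\<lambda>i. X i \<omega>) {1..n}) n) = Z"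
    unfolding assms(5) by (auto intro!: perturbed_prod_cong)
  finally have Z[measurable]: "Z \<in> borel_measurable M" .
  have Z': "?Z' \<in> borel_measurable M" by measurable
  have "\<exists>K. AE \<omega> in M. norm (X i \<omega>) \<le> K" if "i \<in> {1..n}" for i
    using AE_norm_le_of_spectral[OF assms(4)[OF that]] by blast
  then have "\<exists>K. AE \<omega> in M. norm (Z \<omega>) \<le> K"
    unfolding assms(5) by (rule perturbed_prod_bounded)
  then obtain K where K: "AE \<omega> in M. norm (Z \<omega>) \<le> K" ..
  have K': "AE \<omega> in M. norm (?Z' \<omega>) \<le> K + norm (expectation Z)"
    using K
  proof eventually_elim
    case (elim \<omega>)
    then show ?case using norm_triangle_ineq4[of "Z \<omega>" "expectation Z"] by linarith
  qed
  have d: "d \<ge> 1" "d > 0" unfolding assms(8) by simp_all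
  have v: "v \<ge> 0" unfolding assms(7) by (intro sum_nonneg) auto
  have e_nonneg: "exp ((2 * real m - 1) * v) - 1 \<ge> 0" if "m > 0" for m
    using v that by simp
  have norm_growth: "expectation (\<lambda>\<omega>. spectral_norm (Z \<omega>)) \<le>
      d powr (1 / (2 * real m)) * sqrt (exp (2 * ?s + (2 * real m - 1) * v))" if "m > 0" for m
    by (rule expectation_spectral_norm_le[OF that Z K d(2) _ growth[OF that]]) simp
  have norm_fluct: "expectation (\<lambda>\<omega>. spectral_norm (?Z' \<omega>)) \<le>
      d powr (1 / (2 * real m)) * sqrt (exp (2 * ?s) * (exp ((2 * real m - 1) * v) - 1))"
    if "m > 0" for m
    by (rule expectation_spectral_norm_le[OF that Z' K' d(2) _ fluct[OF that]])
       (use e_nonneg[OF that] in simp)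
  have part1: "expectation (\<lambda>\<omega>. spectral_norm (Z \<omega>)) \<le> exp (?s + sqrt (2 * v * ln d))"
    if le: "2 * v \<le> ln d"
  proof (cases "v = 0")
    case False
    with v have "v > 0" by simp
    from growth_exponent[OF d(1) this le, of ?s] obtain m where "m > 0"
      "d powr (1 / (2 * real m)) * sqrt (exp (2 * ?s + (2 * real m - 1) * v))
        \<le> exp (?s + sqrt (2 * v * ln d))" .
    with norm_growth[of m] show ?thesis by linarith
  next
    case True
    \<comment> \<open>For \<open>v = 0\<close> the optimal exponent is infinite: along
      \<open>p = 2 * Suc n\<close> the dimension factor tends to 1. The bound variable
      \<open>n\<close> is a running index here, not the number of factors.\<close>
    have le: "expectation (\<lambda>\<omega>. spectral_norm (Z \<omega>)) \<le> d powr (inverse (real (Suc n)) / 2) * exp ?s" for n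
    proof -
      have "sqrt (exp (2 * ?s)) = exp ?s" by (simp add: exp_double)
      then show ?thesis using norm_growth[of "Suc n"] True
        by (simp add: inverse_eq_divide mult.commute[of 2] del: of_nat_Suc)
    qed
    have "(\<lambda>n. d powr (inverse (real (Suc n)) / 2) * exp ?s) \<longlonglongrightarrow> d powr (0 / 2) * exp ?s"
      using d by (intro tendsto_intros LIMSEQ_inverse_real_of_nat) auto
    then have "expectation (\<lambda>\<omega>. spectral_norm (Z \<omega>)) \<le> d powr (0 / 2) * exp ?s"
      by (rule LIMSEQ_le_const) (use le in blast)
    then show ?thesis using d True by simp
  qed
  have part2: "expectation (\<lambda>\<omega>. spectral_norm (?Z' \<omega>)) \<le> exp (?s + 1) * sqrt (v * (1 + 2 * ln d))"
    if "v * (1 + 2 * ln d) \<le> 1"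
  proof -
    from fluctuation_exponent[OF d(1) v that, of ?s] obtain m where "m > 0"
      "d powr (1 / (2 * real m)) * sqrt (exp (2 * ?s) * (exp ((2 * real m - 1) * v) - 1))
        \<le> exp (?s + 1) * sqrt (v * (1 + 2 * ln d))" .
    with norm_fluct[of m] show ?thesis by linarith
  qed
  have part3: "\<P>(\<omega> in M. spectral_norm (Z \<omega>) \<ge> t * exp ?s) \<le> d * exp (- (ln t)\<^sup>2 / (2 * v))"
    if "v > 0" "t > 0" "ln t \<ge> 2 * v" for t
  proof -
    from growth_tail_exponent[OF that, of ?s] obtain m where m: "m > 0"
      "(exp (2 * ?s + (2 * real m - 1) * v) / (t * exp ?s)\<^sup>2) ^ m \<le> exp (- (ln t)\<^sup>2 / (2 * v))" .
    have "\<P>(\<omega> in M. spectral_norm (Z \<omega>) \<ge> t * exp ?s) \<le>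
        d * (exp (2 * ?s + (2 * real m - 1) * v) / (t * exp ?s)\<^sup>2) ^ m"
      by (rule prob_spectral_norm_le[OF m(1) Z K _ growth[OF m(1)]]) (use that in simp)
    also have "\<dots> \<le> d * exp (- (ln t)\<^sup>2 / (2 * v))"
      using m(2) d by (intro mult_left_mono) auto
    finally show ?thesis .
  qed
  have part4: "\<P>(\<omega> in M. spectral_norm (?Z' \<omega>) \<ge> t * exp ?s)
      \<le> max d (exp 1) * exp (- t\<^sup>2 / (2 * (exp 1)\<^sup>2 * v))"
    if "v > 0" "0 \<le> t" "t \<le> exp 1" for t
  proof (cases "t\<^sup>2 \<ge> 2 * (exp 1)\<^sup>2 * v")
    case True
    have "2 * (exp 1)\<^sup>2 * v > 0" using that by simp
    with True have "t\<^sup>2 > 0" by linarith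
    with that have t: "t > 0" by simp
    from fluctuation_tail_exponent[OF that(1) t that(3) True, of ?s] obtain m where m: "m > 0"
      "(exp (2 * ?s) * (exp ((2 * real m - 1) * v) - 1) / (t * exp ?s)\<^sup>2) ^ m
        \<le> exp (- t\<^sup>2 / (2 * (exp 1)\<^sup>2 * v))" .
    have "\<P>(\<omega> in M. spectral_norm (?Z' \<omega>) \<ge> t * exp ?s) \<le>
        d * (exp (2 * ?s) * (exp ((2 * real m - 1) * v) - 1) / (t * exp ?s)\<^sup>2) ^ m"
      by (rule prob_spectral_norm_le[OF m(1) Z' K' _ fluct[OF m(1)]]) (use t in simp)
    also have "\<dots> \<le> max d (exp 1) * exp (- t\<^sup>2 / (2 * (exp 1)\<^sup>2 * v))"
      using m d e_nonneg[OF m(1)] by (intro mult_mono) auto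
    finally show ?thesis .
  next
    case False
    \<comment> \<open>For such small \<open>t\<close> the exponent is above -1, so the claimed bound
      is at least \<open>e / e = 1\<close> and holds trivially; the maximum with \<open>e\<close>
      serves this range.\<close>
    have "\<P>(\<omega> in M. spectral_norm (?Z' \<omega>) \<ge> t * exp ?s) \<le> exp 1 * exp (- 1 :: real)"
      by (simp flip: exp_add)
    also have "\<dots> \<le> max d (exp 1) * exp (- t\<^sup>2 / (2 * (exp 1)\<^sup>2 * v))"
      using False that by (intro mult_mono) (auto simp: divide_le_eq)
    finally show ?thesis .
  qed
  show ?thesis using part1 part2 part3 part4 by blast
qed

end
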